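(* Assume $\sigma^2=o(np)$. Then there exists some $\delta=o(1)$ such that $$\inf_{\widehat{z}\in\mathbb{C}_1^n}\sup_{z\in\mathbb{C}_1^n}\mathbb{E}_z\,\ell(\widehat{z},z)\geq (1-\delta)\frac{\sigma^2}{2p},$$ where the infimum is over all estimators $\widehat z$ (measurable functions of the data $(A,A\circ Y)$ with values in $\mathbb{C}_1^n$). In particular, $\delta$ can be chosen to satisfy $\delta=O\left(\frac{\sigma^2}{np}+\frac{1}{n}\right)$.
   Context: Asymptotic conventions: $n\to\infty$; $p=p_n\in(0,1]$ and $\sigma=\sigma_n>0$ may depend on $n$; $o(\cdot)$, $O(\cdot)$ are as $n\to\infty$; $\delta=\delta_n$ is a sequence, and the inequality is understood for all sufficiently large $n$. Model: $\mathbb{C}_1=\{x\in\mathbb{C}:|x|=1\}$. Under $\mathbb{E}_z$, $z\in\mathbb{C}_1^n$, the data are distributed as follows: for $1\le j<k\le n$, $A_{jk}\sim\text{Bernoulli}(p)$ independently, and $Y_{jk}=z_j\bar z_k+\sigma W_{jk}$, where the $W_{jk}$ are i.i.d. standard complex Gaussian $\mathcal{CN}(0,1)$ (real and imaginary parts are independent $\mathcal N(0,1/2)$), independent of $A$. Set $A_{kj}=A_{jk}$, $Y_{kj}=\bar Y_{jk}$ for $j<k$, and $A_{jj}=Y_{jj}=0$. The data are $A$ and the Hadamard product $A\circ Y=(A_{jk}Y_{jk})$. Loss: $\ell(\widehat z,z)=\min_{a\in\mathbb{C}_1}\sum_{j=1}^n|\widehat z_j a-z_j|^2$. *)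

theory Defs
  imports "HOL-Probability.Probability"
begin

text \<open>
  Vertices are \<open>0, \<dots>, n - 1\<close> instead of \<open>1, \<dots>, n\<close>; an \<open>n \<times> n\<close> array is an extensional function on
  \<open>{..<n} \<times> {..<n}\<close>, and the adjacency entries \<open>A\<^sub>j\<^sub>k\<close> are Booleans, to be read through
  \<^const>\<open>of_bool\<close> as \<open>0\<close> or \<open>1\<close>.
\<close>

definition std_complex_gaussian :: "complex measure" where
  "std_complex_gaussian =
     distr (density lborel (\<lambda>x. ennreal (normal_density 0 (sqrt (1/2)) x)) \<Otimes>\<^sub>M
            density lborel (\<lambda>y. ennreal (normal_density 0 (sqrt (1/2)) y)))
       borel (\<lambda>(x, y). Complex x y)"

definition upper_pairs :: "nat \<Rightarrow> (nat \<times> nat) set" where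
  "upper_pairs n = {(j, k). j < k \<and> k < n}"

definition noise :: "nat \<Rightarrow> real \<Rightarrow> ((nat \<times> nat \<Rightarrow> bool) \<times> (nat \<times> nat \<Rightarrow> complex)) measure" where
  "noise n p =
     (\<Pi>\<^sub>M jk\<in>upper_pairs n. measure_pmf (bernoulli_pmf p)) \<Otimes>\<^sub>M
     (\<Pi>\<^sub>M jk\<in>upper_pairs n. std_complex_gaussian)"

definition adjacency :: "nat \<Rightarrow> (nat \<times> nat \<Rightarrow> bool) \<Rightarrow> nat \<times> nat \<Rightarrow> bool" where
  "adjacency n B = (\<lambda>(j, k)\<in>{..<n} \<times> {..<n}.
     if j < k then B (j, k) else if k < j then B (k, j) else False)"

definition measurement ::
  "nat \<Rightarrow> real \<Rightarrow> (nat \<Rightarrow> complex) \<Rightarrow> (nat \<times> nat \<Rightarrow> complex) \<Rightarrow> nat \<times> nat \<Rightarrow> complex" where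
  "measurement n \<sigma> z W = (\<lambda>(j, k)\<in>{..<n} \<times> {..<n}.
     if j < k then z j * cnj (z k) + of_real \<sigma> * W (j, k)
     else if k < j then cnj (z k * cnj (z j) + of_real \<sigma> * W (k, j))
     else 0)"

definition data_space :: "nat \<Rightarrow> ((nat \<times> nat \<Rightarrow> bool) \<times> (nat \<times> nat \<Rightarrow> complex)) measure" where
  "data_space n =
     (\<Pi>\<^sub>M jk\<in>{..<n} \<times> {..<n}. count_space UNIV) \<Otimes>\<^sub>M (\<Pi>\<^sub>M jk\<in>{..<n} \<times> {..<n}. borel)"

definition observed_data ::
  "nat \<Rightarrow> real \<Rightarrow> (nat \<Rightarrow> complex) \<Rightarrow> (nat \<times> nat \<Rightarrow> bool) \<times> (nat \<times> nat \<Rightarrow> complex)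
    \<Rightarrow> (nat \<times> nat \<Rightarrow> bool) \<times> (nat \<times> nat \<Rightarrow> complex)" where
  "observed_data n \<sigma> z = (\<lambda>(B, W).
     (adjacency n B,
      \<lambda>jk\<in>{..<n} \<times> {..<n}. of_bool (adjacency n B jk) * measurement n \<sigma> z W jk))"

definition data_law ::
  "nat \<Rightarrow> real \<Rightarrow> real \<Rightarrow> (nat \<Rightarrow> complex)
    \<Rightarrow> ((nat \<times> nat \<Rightarrow> bool) \<times> (nat \<times> nat \<Rightarrow> complex)) measure" where
  "data_law n p \<sigma> z = distr (noise n p) (data_space n) (observed_data n \<sigma> z)"

definition phase_space :: "nat \<Rightarrow> (nat \<Rightarrow> complex) measure" where
  "phase_space n = (\<Pi>\<^sub>M j\<in>{..<n}. restrict_space borel (sphere 0 1))"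

definition estimators ::
  "nat \<Rightarrow> ((nat \<times> nat \<Rightarrow> bool) \<times> (nat \<times> nat \<Rightarrow> complex) \<Rightarrow> nat \<Rightarrow> complex) set" where
  "estimators n = data_space n \<rightarrow>\<^sub>M phase_space n"

text \<open>The infimum is a minimum: a continuous function on the compact unit circle.\<close>

definition loss :: "nat \<Rightarrow> (nat \<Rightarrow> complex) \<Rightarrow> (nat \<Rightarrow> complex) \<Rightarrow> real" where
  "loss n zh z = (INF a\<in>sphere 0 1. \<Sum>j<n. (norm (zh j * a - z j))\<^sup>2)"

text \<open>
  The loss is nonnegative, so its expectation is a nonnegative integral and the infimum and supremum
  can be taken in \<^typ>\<open>ennreal\<close>, where they always exist.
\<close>

definition minimax_risk :: "nat \<Rightarrow> real \<Rightarrow> real \<Rightarrow> ennreal" where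
  "minimax_risk n p \<sigma> =
     (INF zh\<in>estimators n. SUP z\<in>({..<n} \<rightarrow>\<^sub>E sphere 0 1).
        \<integral>\<^sup>+ d. ennreal (loss n (zh d) z) \<partial>data_law n p \<sigma> z)"

end

theory Submission imports Defs "HOL-Real_Asymp.Real_Asymp" begin

text \<open>
  Let \<open>u\<close> be the estimate of \<open>z\<close>. As all entries are unimodular, the loss dominates the average
  \<open>(1 / 2n) \<Sum>\<^sub>j\<^sub>,\<^sub>k |u\<^sub>j cnj u\<^sub>k - z\<^sub>j cnj z\<^sub>k|\<^sup>2\<close>, which no longer involves a global rotation
  (\<open>pair_loss_le_loss\<close>). So it suffices that every relative phase \<open>z\<^sub>j cnj z\<^sub>k\<close> with \<open>j \<noteq> k\<close> is
  hard to estimate: the mean square error cannot be essentially smaller than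
  \<open>\<epsilon> = \<sigma>\<^sup>2 / (n p)\<close>. Summed over the \<open>n (n - 1)\<close> pairs this gives \<open>(n - 1) \<epsilon> / 2\<close>, which is
  \<open>\<sigma>\<^sup>2 / (2 p)\<close> up to a factor \<open>1 - 1 / n\<close>.

  The bound for one pair is a Bayesian Cramer-Rao (van Trees) argument. Under a rotation-invariant
  prior on the torus, turn \<open>z\<^sub>j\<close> by \<open>h\<close> and \<open>z\<^sub>k\<close> by \<open>-h\<close>. The prior is unchanged, so it
  contributes no information and there is no boundary term; the relative phase turns by \<open>2h\<close>; and
  the law of the data changes by a likelihood ratio \<open>R\<close> whose variance is about \<open>4 n p h\<^sup>2 / \<sigma>\<^sup>2\<close>.
  With the unimodular error \<open>X = (u\<^sub>j cnj u\<^sub>k) cnj (z\<^sub>j cnj z\<^sub>k)\<close>, invariance says that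
  \<open>E X = cis (-2h) E (R X)\<close>, so the correlation of \<open>Im X\<close> with \<open>R - 1\<close> is about \<open>2h E (Re X)\<close>,
  and Cauchy-Schwarz bounds this by \<open>Var R\<close> and \<open>E (Im X)\<^sup>2 \<le> 1 - (E (Re X))\<^sup>2\<close>. As \<open>h\<close> tends to \<open>0\<close> the
  result is \<open>E (Re X) \<le> 1 / sqrt (1 + \<epsilon>)\<close>, and \<open>E |X - 1|\<^sup>2 = 2 - 2 E (Re X)\<close> is at least
  \<open>\<epsilon> - 3 \<epsilon>\<^sup>2 / 4\<close>.

  Two choices keep this elementary. Finite differences in \<open>h\<close> (as in the Chapman-Robbins bound)
  replace the derivative of the likelihood, so no differentiation under the integral occurs and
  only the exact second moment of a Gaussian likelihood ratio is needed
  (\<open>nn_integral_likelihood_ratio_power2\<close>). The prior is uniform on the \<open>n\<close>-tuples of \<open>m\<close>-th roots of unity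
  and \<open>h = 2 \<pi> / m\<close>: this finite group is already invariant under the turn, so
  averaging over the prior is a finite sum (\<open>sum_phase_correlation_le\<close>), and \<open>m\<close> tends to infinity at the
  end (\<open>minimax_risk_ge\<close>). The resulting bound \<open>(n - 1) (1 - 1 / sqrt (1 + \<epsilon>))\<close> is non-asymptotic.
\<close>

section \<open>Shifting a complex Gaussian\<close>

text \<open>
  The density of \<open>CN(c, 1)\<close> with respect to \<open>CN(0, 1)\<close>: the quotient of \<open>exp (- |w - c|\<^sup>2)\<close> and
  \<open>exp (- |w|\<^sup>2)\<close>.
\<close>

definition tilt :: "complex \<Rightarrow> complex \<Rightarrow> real" where
  "tilt c w = exp (2 * Re (w * cnj c) - (cmod c)\<^sup>2)"

lemma tilt_nonneg [simp]: "0 \<le> tilt c w"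
  by (simp add: tilt_def)

lemma measurable_tilt [measurable]:
  assumes "f \<in> borel_measurable M" "g \<in> borel_measurable M"
  shows "(\<lambda>x. tilt (f x) (g x)) \<in> borel_measurable M"
proof -
  have "continuous_on UNIV (\<lambda>(c, w). tilt c w)"
    unfolding tilt_def case_prod_unfold by (intro continuous_intros)
  then have "(\<lambda>(c, w). tilt c w) \<in> borel_measurable (borel :: (complex \<times> complex) measure)"
    by (rule borel_measurable_continuous_onI)
  then have "(\<lambda>(c, w). tilt c w) \<in> borel_measurable (borel \<Otimes>\<^sub>M borel)"
    by (simp add: borel_prod)
  from measurable_compose[OF measurable_Pair[OF assms] this] show ?thesis
    by simp
qed

text \<open>
  A squared tilt is again a tilt, by twice the shift, up to a constant. As every tilt integrates to
  \<open>1\<close>, this yields second moments of likelihood ratios without computing a Gaussian integral.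
\<close>

lemma tilt_power2: "(tilt c w)\<^sup>2 = exp (2 * (cmod c)\<^sup>2) * tilt (2 * c) w"
  by (simp add: tilt_def norm_mult power_mult_distrib flip: exp_double exp_add)

text \<open>
  Variance \<open>1/2\<close> makes the exponent of the density \<open>- x\<^sup>2\<close>, hence the form of the factor.
\<close>

lemma nn_integral_normal_shift:
  assumes [measurable]: "f \<in> borel_measurable borel"
  shows "(\<integral>\<^sup>+ x. f (x + a) \<partial>density lborel (normal_density 0 (sqrt (1/2)))) =
         (\<integral>\<^sup>+ x. f x * ennreal (exp (2 * a * x - a\<^sup>2)) \<partial>density lborel (normal_density 0 (sqrt (1/2))))"
proof -
  let ?d = "normal_density 0 (sqrt (1/2))"
  have d: "?d (x - a) = ?d x * exp (2 * a * x - a\<^sup>2)" for x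
    by (simp add: normal_density_def flip: exp_add) (simp add: power2_eq_square algebra_simps)
  have "(\<integral>\<^sup>+ x. f (x + a) \<partial>density lborel ?d) = (\<integral>\<^sup>+ x. ?d x * f (x + a) \<partial>lborel)"
    by (subst nn_integral_density) auto
  also have "\<dots> = (\<integral>\<^sup>+ x. ?d (x - a) * f x \<partial>lborel)"
    by (subst nn_integral_real_affine[where c = 1 and t = a]) (auto simp: add.commute)
  also have "\<dots> = (\<integral>\<^sup>+ x. ?d x * (f x * ennreal (exp (2 * a * x - a\<^sup>2))) \<partial>lborel)"
    by (simp add: d ennreal_mult mult_ac)
  also have "\<dots> = (\<integral>\<^sup>+ x. f x * ennreal (exp (2 * a * x - a\<^sup>2)) \<partial>density lborel ?d)"
    by (subst nn_integral_density) auto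
  finally show ?thesis .
qed

lemma prob_space_half_normal: "prob_space (density lborel (normal_density 0 (sqrt (1/2))))"
  by (rule prob_space_normal_density) simp

lemma measurable_Complex_pair [measurable]:
  "(\<lambda>(x, y). Complex x y) \<in> borel_measurable (borel \<Otimes>\<^sub>M borel)"
proof -
  have "(\<lambda>(x, y). Complex x y) = (\<lambda>q. of_real (fst q) + \<i> * of_real (snd q))"
    by (auto simp: complex_eq_iff)
  then show ?thesis
    by simp
qed

lemma sets_std_complex_gaussian [measurable_cong, simp]: "sets std_complex_gaussian = sets borel"
  by (simp add: std_complex_gaussian_def)

lemma prob_space_std_complex_gaussian: "prob_space std_complex_gaussian"
proof -
  interpret N: prob_space "density lborel (normal_density 0 (sqrt (1/2)))"
    by (rule prob_space_half_normal)
  interpret pair_prob_space "density lborel (normal_density 0 (sqrt (1/2)))"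
      "density lborel (normal_density 0 (sqrt (1/2)))" ..
  show ?thesis
    unfolding std_complex_gaussian_def by (rule prob_space_distr) measurable
qed

lemma nn_integral_std_complex_gaussian:
  assumes [measurable]: "f \<in> borel_measurable borel"
  shows "(\<integral>\<^sup>+ w. f w \<partial>std_complex_gaussian) =
    (\<integral>\<^sup>+ x. \<integral>\<^sup>+ y. f (Complex x y) \<partial>density lborel (normal_density 0 (sqrt (1/2)))
       \<partial>density lborel (normal_density 0 (sqrt (1/2))))"
proof -
  interpret N: prob_space "density lborel (normal_density 0 (sqrt (1/2)))"
    by (rule prob_space_half_normal)
  show ?thesis
    unfolding std_complex_gaussian_def
    apply (subst nn_integral_distr)
    apply measurable
    apply (subst N.nn_integral_fst[symmetric])
    apply simp_all
    done
qed

lemma nn_integral_std_complex_gaussian_shift: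
  assumes [measurable]: "f \<in> borel_measurable borel"
  shows "(\<integral>\<^sup>+ w. f (w + c) \<partial>std_complex_gaussian) =
    (\<integral>\<^sup>+ w. f w * ennreal (tilt c w) \<partial>std_complex_gaussian)"
proof -
  let ?N = "density lborel (normal_density 0 (sqrt (1/2)))"
  interpret N: prob_space ?N
    by (rule prob_space_half_normal)
  define r where "r a x = ennreal (exp (2 * a * x - a\<^sup>2))" for a x :: real
  have [measurable]: "r a \<in> borel_measurable borel" for a
    unfolding r_def by measurable
  have C [measurable]: "(\<lambda>y. f (Complex x y)) \<in> borel_measurable borel"
       "(\<lambda>q. f (Complex (fst q) (snd q))) \<in> borel_measurable (borel \<Otimes>\<^sub>M borel)" for x
    using measurable_Complex_pair[measurable] by (simp_all add: case_prod_unfold)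
  have tilt: "ennreal (tilt c (Complex x y)) = r (Re c) x * r (Im c) y" for x y
    by (simp add: r_def tilt_def cmod_power2 algebra_simps flip: ennreal_mult exp_add)
  have "(\<integral>\<^sup>+ w. f (w + c) \<partial>std_complex_gaussian) =
      (\<integral>\<^sup>+ x. (\<integral>\<^sup>+ y. f (Complex (x + Re c) (y + Im c)) \<partial>?N) \<partial>?N)"
    by (subst nn_integral_std_complex_gaussian) (auto intro!: nn_integral_cong arg_cong[of _ _ f] simp: complex_eq_iff)
  also have "\<dots> = (\<integral>\<^sup>+ x. (\<integral>\<^sup>+ y. f (Complex (x + Re c) y) * r (Im c) y \<partial>?N) \<partial>?N)"
    unfolding r_def by (subst nn_integral_normal_shift[of "\<lambda>y. f (Complex (_ + Re c) y)"]) auto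
  also have "\<dots> = (\<integral>\<^sup>+ x. (\<integral>\<^sup>+ y. f (Complex x y) * r (Im c) y \<partial>?N) * r (Re c) x \<partial>?N)"
    unfolding r_def
    by (rule nn_integral_normal_shift[of "\<lambda>x. \<integral>\<^sup>+ y. f (Complex x y) * r (Im c) y \<partial>?N", unfolded r_def])
       measurable
  also have "\<dots> = (\<integral>\<^sup>+ x. (\<integral>\<^sup>+ y. f (Complex x y) * ennreal (tilt c (Complex x y)) \<partial>?N) \<partial>?N)"
    by (subst nn_integral_multc[symmetric]) (auto simp: tilt mult_ac)
  also have "\<dots> = (\<integral>\<^sup>+ w. f w * ennreal (tilt c w) \<partial>std_complex_gaussian)"
    by (rule nn_integral_std_complex_gaussian[symmetric]) measurable
  finally show ?thesis .
qed

lemma distr_std_complex_gaussian_shift: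
  "distr std_complex_gaussian borel (\<lambda>w. w + c) = density std_complex_gaussian (\<lambda>w. ennreal (tilt c w))"
proof (rule measure_eqI)
  fix A assume "A \<in> sets (distr std_complex_gaussian borel (\<lambda>w. w + c))"
  then have [measurable]: "A \<in> sets borel"
    by simp
  have "emeasure (distr std_complex_gaussian borel (\<lambda>w. w + c)) A =
      (\<integral>\<^sup>+ w. indicator A w \<partial>distr std_complex_gaussian borel (\<lambda>w. w + c))"
    by simp
  also have "\<dots> = (\<integral>\<^sup>+ w. indicator A (w + c) \<partial>std_complex_gaussian)"
    by (rule nn_integral_distr) measurable
  also have "\<dots> = emeasure (density std_complex_gaussian (\<lambda>w. ennreal (tilt c w))) A"
    by (subst nn_integral_std_complex_gaussian_shift, measurable, subst emeasure_density, measurable)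
       (simp add: mult.commute)
  finally show "emeasure (distr std_complex_gaussian borel (\<lambda>w. w + c)) A =
      emeasure (density std_complex_gaussian (\<lambda>w. ennreal (tilt c w))) A" .
qed simp

section \<open>The likelihood ratio of two signals\<close>

lemma finite_upper_pairs [simp]: "finite (upper_pairs n)"
  by (rule finite_subset[of _ "{..<n} \<times> {..<n}"]) (auto simp: upper_pairs_def)

definition prod_tilt :: "'i set \<Rightarrow> ('i \<Rightarrow> complex) \<Rightarrow> ('i \<Rightarrow> complex) \<Rightarrow> real" where
  "prod_tilt I c W = (\<Prod>i\<in>I. tilt (c i) (W i))"

lemma prod_tilt_nonneg [simp]: "0 \<le> prod_tilt I c W"
  by (simp add: prod_tilt_def prod_nonneg)

lemma measurable_prod_tilt [measurable]:
  "prod_tilt I c \<in> borel_measurable (\<Pi>\<^sub>M i\<in>I. std_complex_gaussian)"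
  unfolding prod_tilt_def by measurable

lemma prod_tilt_power2:
  "(prod_tilt I c W)\<^sup>2 = exp (2 * (\<Sum>i\<in>I. (cmod (c i))\<^sup>2)) * prod_tilt I (\<lambda>i. 2 * c i) W"
  by (cases "finite I")
     (simp_all add: prod_tilt_def prod_power_distrib tilt_power2 prod.distrib sum_distrib_left exp_sum)

text \<open>
  Both sides are the product of the shifted Gaussians: they agree with it on rectangles, the left one
  because the shift acts coordinatewise and the right one by integrating a product of one-variable
  functions.
\<close>

lemma distr_PiM_gaussian_shift:
  assumes I: "finite I"
  defines "G \<equiv> \<Pi>\<^sub>M i\<in>I. std_complex_gaussian"
  shows "distr G G (\<lambda>W. \<lambda>i\<in>I. W i + c i) = density G (\<lambda>W. ennreal (prod_tilt I c W))"
proof -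
  interpret G: prob_space std_complex_gaussian
    by (rule prob_space_std_complex_gaussian)
  interpret P: product_sigma_finite "\<lambda>_. std_complex_gaussian" ..
  let ?D = "\<lambda>i. density std_complex_gaussian (\<lambda>w. ennreal (tilt (c i) w))"
  have sp: "space std_complex_gaussian = UNIV"
    using sets_eq_imp_space_eq[OF sets_std_complex_gaussian] by simp
  have D: "prob_space (?D i)" for i
    unfolding distr_std_complex_gaussian_shift[symmetric]
    by (rule G.prob_space_distr) simp
  have shift [measurable]: "(\<lambda>W. \<lambda>i\<in>I. W i + c i) \<in> G \<rightarrow>\<^sub>M G"
    unfolding G_def by measurable
  have prod_tilt [measurable]: "prod_tilt I c \<in> borel_measurable G"
    unfolding G_def by measurable
  interpret PD: product_prob_space ?D I
    by (rule product_prob_spaceI) (rule D)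
  have sets: "sets (PiM I ?D) = sets G"
    unfolding G_def by (rule sets_PiM_cong) simp_all
  have "distr G G (\<lambda>W. \<lambda>i\<in>I. W i + c i) = PiM I ?D"
  proof (rule PD.PiM_eqI[OF I])
    fix A assume A: "\<And>i. i \<in> I \<Longrightarrow> A i \<in> sets (?D i)"
    then have [measurable]: "\<And>i. i \<in> I \<Longrightarrow> A i \<in> sets borel"
      by simp
    have mA: "Pi\<^sub>E I A \<in> sets G"
      unfolding G_def using I by (intro sets_PiM_I_finite) auto
    have "emeasure (distr G G (\<lambda>W. \<lambda>i\<in>I. W i + c i)) (Pi\<^sub>E I A) =
        emeasure G (\<Pi>\<^sub>E i\<in>I. (\<lambda>w. w + c i) -` A i)"
      by (subst emeasure_distr[OF shift mA], rule arg_cong[of _ _ "emeasure G"])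
         (auto simp: G_def space_PiM sp PiE_iff)
    also have "\<dots> = (\<Prod>i\<in>I. emeasure std_complex_gaussian ((\<lambda>w. w + c i) -` A i))"
      unfolding G_def by (rule P.emeasure_PiM[OF I]) (auto intro!: measurable_sets_borel[where M = borel])
    also have "\<dots> = (\<Prod>i\<in>I. emeasure (?D i) (A i))"
      unfolding distr_std_complex_gaussian_shift[symmetric]
      by (rule prod.cong[OF refl]) (subst emeasure_distr, auto simp: sp)
    finally show "emeasure (distr G G (\<lambda>W. \<lambda>i\<in>I. W i + c i)) (Pi\<^sub>E I A) =
      (\<Prod>i\<in>I. emeasure (?D i) (A i))" .
  qed (simp add: sets)
  also have "PiM I ?D = density G (\<lambda>W. ennreal (prod_tilt I c W))"
  proof (rule PD.PiM_eqI[OF I, symmetric])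
    fix A assume A: "\<And>i. i \<in> I \<Longrightarrow> A i \<in> sets (?D i)"
    then have [measurable]: "\<And>i. i \<in> I \<Longrightarrow> A i \<in> sets borel"
      by simp
    have mA: "Pi\<^sub>E I A \<in> sets G"
      unfolding G_def using I by (intro sets_PiM_I_finite) auto
    have "emeasure (density G (\<lambda>W. ennreal (prod_tilt I c W))) (Pi\<^sub>E I A) =
        (\<integral>\<^sup>+ W. ennreal (prod_tilt I c W) * indicator (Pi\<^sub>E I A) W \<partial>G)"
      using mA by (simp add: emeasure_density)
    also have "\<dots> = (\<integral>\<^sup>+ W. (\<Prod>i\<in>I. ennreal (tilt (c i) (W i)) * indicator (A i) (W i)) \<partial>G)"
      using I by (intro nn_integral_cong)
        (auto simp: prod_tilt_def prod.distrib indicator_def PiE_iff G_def space_PiM prod_ennreal[symmetric]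
          prod_zero_iff)
    also have "\<dots> = (\<Prod>i\<in>I. emeasure (?D i) (A i))"
      unfolding G_def using I
      by (subst P.product_nn_integral_prod) (auto simp: emeasure_density intro!: prod.cong)
    finally show "emeasure (density G (\<lambda>W. ennreal (prod_tilt I c W))) (Pi\<^sub>E I A) =
      (\<Prod>i\<in>I. emeasure (?D i) (A i))" .
  qed (simp add: sets)
  finally show ?thesis .
qed

lemma nn_integral_PiM_gaussian_shift:
  assumes I: "finite I"
    and f [measurable]: "f \<in> borel_measurable (\<Pi>\<^sub>M i\<in>I. std_complex_gaussian)"
  shows "(\<integral>\<^sup>+ W. f (\<lambda>i\<in>I. W i + c i) \<partial>(\<Pi>\<^sub>M i\<in>I. std_complex_gaussian)) =
    (\<integral>\<^sup>+ W. ennreal (prod_tilt I c W) * f W \<partial>(\<Pi>\<^sub>M i\<in>I. std_complex_gaussian))"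
proof -
  let ?G = "\<Pi>\<^sub>M i\<in>I. std_complex_gaussian"
  have "(\<integral>\<^sup>+ W. f (\<lambda>i\<in>I. W i + c i) \<partial>?G) = (\<integral>\<^sup>+ W. f W \<partial>distr ?G ?G (\<lambda>W. \<lambda>i\<in>I. W i + c i))"
    by (rule nn_integral_distr[symmetric]) measurable
  also have "\<dots> = (\<integral>\<^sup>+ W. f W \<partial>density ?G (\<lambda>W. ennreal (prod_tilt I c W)))"
    by (simp add: distr_PiM_gaussian_shift[OF I])
  also have "\<dots> = (\<integral>\<^sup>+ W. ennreal (prod_tilt I c W) * f W \<partial>?G)"
    by (rule nn_integral_density) measurable
  finally show ?thesis .
qed

text \<open>
  Only the entries of the observed edges are tilted: the data do not depend on the noise elsewhere,
  and tilting there would lose the factor \<open>p\<close> in the information.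
\<close>

definition likelihood_ratio ::
  "nat \<Rightarrow> (nat \<times> nat \<Rightarrow> complex) \<Rightarrow> (nat \<times> nat \<Rightarrow> bool) \<times> (nat \<times> nat \<Rightarrow> complex) \<Rightarrow> real" where
  "likelihood_ratio n \<Delta> = (\<lambda>(B, W). prod_tilt (upper_pairs n) (\<lambda>e. of_bool (B e) * \<Delta> e) W)"

lemma prob_space_noise: "prob_space (noise n p)"
proof -
  interpret B: prob_space "\<Pi>\<^sub>M jk\<in>upper_pairs n. measure_pmf (bernoulli_pmf p)"
    by (rule prob_space_PiM) (rule prob_space_measure_pmf)
  interpret W: prob_space "\<Pi>\<^sub>M jk\<in>upper_pairs n. std_complex_gaussian"
    by (rule prob_space_PiM) (rule prob_space_std_complex_gaussian)
  interpret pair_prob_space "\<Pi>\<^sub>M jk\<in>upper_pairs n. measure_pmf (bernoulli_pmf p)"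
      "\<Pi>\<^sub>M jk\<in>upper_pairs n. std_complex_gaussian" ..
  show ?thesis
    unfolding noise_def by (rule prob_space_axioms)
qed

lemma nn_integral_noise:
  assumes "f \<in> borel_measurable (noise n p)"
  shows "(\<integral>\<^sup>+ x. f x \<partial>noise n p) =
    (\<integral>\<^sup>+ B. \<integral>\<^sup>+ W. f (B, W) \<partial>(\<Pi>\<^sub>M jk\<in>upper_pairs n. std_complex_gaussian)
       \<partial>(\<Pi>\<^sub>M jk\<in>upper_pairs n. measure_pmf (bernoulli_pmf p)))"
proof -
  interpret W: prob_space "\<Pi>\<^sub>M jk\<in>upper_pairs n. std_complex_gaussian"
    by (rule prob_space_PiM) (rule prob_space_std_complex_gaussian)
  show ?thesis
    using assms unfolding noise_def by (rule W.nn_integral_fst[symmetric])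
qed

lemma measurable_edge [measurable]:
  assumes "e \<in> upper_pairs n"
  shows "(\<lambda>x. fst x e) \<in> noise n p \<rightarrow>\<^sub>M count_space UNIV"
    and "(\<lambda>x. snd x e) \<in> noise n p \<rightarrow>\<^sub>M borel"
proof -
  have "(\<lambda>x. fst x e) \<in> noise n p \<rightarrow>\<^sub>M measure_pmf (bernoulli_pmf p)"
    unfolding noise_def
    by (rule measurable_compose[OF measurable_fst measurable_component_singleton[OF assms]])
  then show "(\<lambda>x. fst x e) \<in> noise n p \<rightarrow>\<^sub>M count_space UNIV"
    by simp
  have "(\<lambda>x. snd x e) \<in> noise n p \<rightarrow>\<^sub>M std_complex_gaussian"
    unfolding noise_def
    by (rule measurable_compose[OF measurable_snd measurable_component_singleton[OF assms]])
  then show "(\<lambda>x. snd x e) \<in> noise n p \<rightarrow>\<^sub>M borel"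
    by (simp cong: measurable_cong_sets)
qed

lemma measurable_likelihood_ratio [measurable]:
  "likelihood_ratio n \<Delta> \<in> borel_measurable (noise n p)"
  unfolding likelihood_ratio_def prod_tilt_def case_prod_unfold by measurable

lemma measurable_adjacency [measurable]:
  "(\<lambda>x. adjacency n (fst x) jk) \<in> noise n p \<rightarrow>\<^sub>M count_space UNIV"
proof (cases jk)
  case (Pair j k)
  consider "j < k" "k < n" | "k < j" "j < n" | "\<not> j < n" | "\<not> k < n" | "j = k" "k < n"
    by linarith
  then show ?thesis
  proof cases
    case 1
    then have "(j, k) \<in> upper_pairs n"
      by (simp add: upper_pairs_def)
    from measurable_edge(1)[OF this] 1 show ?thesis
      by (simp add: adjacency_def Pair)
  next
    case 2
    then have "(k, j) \<in> upper_pairs n"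
      by (simp add: upper_pairs_def)
    from measurable_edge(1)[OF this] 2 show ?thesis
      by (simp add: adjacency_def Pair)
  qed (simp_all add: adjacency_def Pair restrict_def)
qed

lemma measurable_cnj [measurable]: "cnj \<in> borel_measurable borel"
  by (intro borel_measurable_continuous_onI continuous_intros)

lemma measurable_measurement [measurable]:
  "(\<lambda>x. measurement n \<sigma> z (snd x) jk) \<in> borel_measurable (noise n p)"
proof (cases jk)
  case (Pair j k)
  consider "j < k" "k < n" | "k < j" "j < n" | "\<not> j < n" | "\<not> k < n" | "j = k" "k < n"
    by linarith
  then show ?thesis
  proof cases
    case 1
    then have "(j, k) \<in> upper_pairs n"
      by (simp add: upper_pairs_def)
    from borel_measurable_add[OF borel_measurable_const borel_measurable_times[OF borel_measurable_const measurable_edge(2)[OF this]]] 1 show ?thesis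
      by (simp add: measurement_def Pair)
  next
    case 2
    then have "(k, j) \<in> upper_pairs n"
      by (simp add: upper_pairs_def)
    then have "(\<lambda>x. cnj (z k * cnj (z j) + of_real \<sigma> * snd x (k, j))) \<in> borel_measurable (noise n p)"
      using measurable_edge(2)[of "(k, j)" n p] by measurable
    with 2 show ?thesis
      by (simp add: measurement_def Pair)
  qed (simp_all add: measurement_def Pair restrict_def)
qed

lemma measurable_observed_data [measurable]:
  "observed_data n \<sigma> z \<in> noise n p \<rightarrow>\<^sub>M data_space n"
proof -
  have "(\<lambda>x. adjacency n (fst x)) \<in> noise n p \<rightarrow>\<^sub>M (\<Pi>\<^sub>M jk\<in>{..<n} \<times> {..<n}. count_space UNIV)"
  proof -
    have "adjacency n B = (\<lambda>jk\<in>{..<n} \<times> {..<n}. adjacency n B jk)" for B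
      by (auto simp: adjacency_def fun_eq_iff)
    then show ?thesis
      using measurable_restrict[of "{..<n} \<times> {..<n}" "\<lambda>jk x. adjacency n (fst x) jk" "noise n p" "\<lambda>_. count_space UNIV"]
      by simp
  qed
  moreover have "(\<lambda>x. \<lambda>jk\<in>{..<n} \<times> {..<n}. of_bool (adjacency n (fst x) jk) * measurement n \<sigma> z (snd x) jk)
      \<in> noise n p \<rightarrow>\<^sub>M (\<Pi>\<^sub>M jk\<in>{..<n} \<times> {..<n}. borel)"
    by (rule measurable_restrict) measurable
  ultimately show ?thesis
    unfolding observed_data_def data_space_def case_prod_unfold by (rule measurable_Pair)
qed

text \<open>
  The displacement of the mean of each measurement when the signal moves from \<open>z\<close> to \<open>z'\<close>, in units of
  the noise.
\<close>

definition drift :: "real \<Rightarrow> (nat \<Rightarrow> complex) \<Rightarrow> (nat \<Rightarrow> complex) \<Rightarrow> nat \<times> nat \<Rightarrow> complex" where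
  "drift \<sigma> z z' = (\<lambda>(j, k). (z' j * cnj (z' k) - z j * cnj (z k)) / of_real \<sigma>)"

text \<open>
  A change of the signal is indistinguishable from a shift of the noise on the observed edges, which
  is what makes the Gaussian shift formula applicable.
\<close>

lemma observed_data_shift:
  assumes "\<sigma> > 0"
  shows "observed_data n \<sigma> z' (B, W) =
    observed_data n \<sigma> z (B, \<lambda>e\<in>upper_pairs n. W e + of_bool (B e) * drift \<sigma> z z' e)"
proof -
  have "of_bool (adjacency n B jk) * measurement n \<sigma> z' W jk = of_bool (adjacency n B jk) *
      measurement n \<sigma> z (\<lambda>e\<in>upper_pairs n. W e + of_bool (B e) * drift \<sigma> z z' e) jk"
    if "jk \<in> {..<n} \<times> {..<n}" for jk
  proof (cases jk)
    case (Pair j k)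
    with that have "j < n" "k < n"
      by auto
    then consider "j < k" "(j, k) \<in> upper_pairs n" | "k < j" "(k, j) \<in> upper_pairs n" | "j = k"
      unfolding upper_pairs_def by force
    then show ?thesis
      using assms that unfolding Pair
      by cases (simp_all add: adjacency_def measurement_def drift_def distrib_left)
  qed
  then show ?thesis
    unfolding observed_data_def prod.case by (intro arg_cong2[of _ _ _ _ Pair] refl restrict_ext)
qed

lemma nn_integral_noise_change:
  assumes "\<sigma> > 0" and [measurable]: "g \<in> borel_measurable (data_space n)"
  shows "(\<integral>\<^sup>+ x. g (observed_data n \<sigma> z' x) \<partial>noise n p) =
    (\<integral>\<^sup>+ x. ennreal (likelihood_ratio n (drift \<sigma> z z') x) * g (observed_data n \<sigma> z x) \<partial>noise n p)"
proof -
  let ?G = "\<Pi>\<^sub>M jk\<in>upper_pairs n. std_complex_gaussian"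
  let ?B = "\<Pi>\<^sub>M jk\<in>upper_pairs n. measure_pmf (bernoulli_pmf p)"
  have sec: "(\<lambda>W. g (observed_data n \<sigma> z (B, W))) \<in> borel_measurable ?G" if "B \<in> space ?B" for B
  proof -
    have "(\<lambda>x. g (observed_data n \<sigma> z x)) \<in> borel_measurable (?B \<Otimes>\<^sub>M ?G)"
      using measurable_observed_data[of n \<sigma> z p, unfolded noise_def] by measurable
    from measurable_Pair2[OF this that] show ?thesis .
  qed
  have "(\<integral>\<^sup>+ x. g (observed_data n \<sigma> z' x) \<partial>noise n p) =
      (\<integral>\<^sup>+ B. \<integral>\<^sup>+ W. g (observed_data n \<sigma> z
         (B, \<lambda>e\<in>upper_pairs n. W e + of_bool (B e) * drift \<sigma> z z' e)) \<partial>?G \<partial>?B)"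
    by (subst nn_integral_noise) (simp_all add: observed_data_shift[OF assms(1), of n z' _ _ z])
  also have "\<dots> = (\<integral>\<^sup>+ B. \<integral>\<^sup>+ W. ennreal (likelihood_ratio n (drift \<sigma> z z') (B, W)) *
      g (observed_data n \<sigma> z (B, W)) \<partial>?G \<partial>?B)"
    unfolding likelihood_ratio_def prod.case
    by (rule nn_integral_cong, rule nn_integral_PiM_gaussian_shift[OF finite_upper_pairs sec])
  also have "\<dots> = (\<integral>\<^sup>+ x. ennreal (likelihood_ratio n (drift \<sigma> z z') x) * g (observed_data n \<sigma> z x) \<partial>noise n p)"
    by (subst nn_integral_noise) simp_all
  finally show ?thesis .
qed

lemma data_law_change:
  assumes "\<sigma> > 0"
  shows "data_law n p \<sigma> z' = distr (density (noise n p) (\<lambda>x. ennreal (likelihood_ratio n (drift \<sigma> z z') x)))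
    (data_space n) (observed_data n \<sigma> z)"
proof (rule measure_eqI)
  fix A assume "A \<in> sets (data_law n p \<sigma> z')"
  then have [measurable]: "A \<in> sets (data_space n)"
    by (simp add: data_law_def)
  let ?D = "density (noise n p) (\<lambda>x. ennreal (likelihood_ratio n (drift \<sigma> z z') x))"
  have "emeasure (data_law n p \<sigma> z') A = (\<integral>\<^sup>+ x. indicator A x \<partial>data_law n p \<sigma> z')"
    by (simp add: data_law_def)
  also have "\<dots> = (\<integral>\<^sup>+ x. indicator A (observed_data n \<sigma> z' x) \<partial>noise n p)"
    unfolding data_law_def by (rule nn_integral_distr) measurable
  also have "\<dots> = (\<integral>\<^sup>+ x. ennreal (likelihood_ratio n (drift \<sigma> z z') x) *
      indicator A (observed_data n \<sigma> z x) \<partial>noise n p)"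
    by (rule nn_integral_noise_change[OF assms]) measurable
  also have "\<dots> = (\<integral>\<^sup>+ x. indicator A (observed_data n \<sigma> z x) \<partial>?D)"
    by (rule nn_integral_density[symmetric]) measurable
  also have "\<dots> = (\<integral>\<^sup>+ x. indicator A x \<partial>distr ?D (data_space n) (observed_data n \<sigma> z))"
    by (rule nn_integral_distr[symmetric]) measurable
  also have "\<dots> = emeasure (distr ?D (data_space n) (observed_data n \<sigma> z)) A"
    by simp
  finally show "emeasure (data_law n p \<sigma> z') A =
      emeasure (distr ?D (data_space n) (observed_data n \<sigma> z)) A" .
qed (simp add: data_law_def)

lemma nn_integral_prod_tilt:
  assumes "finite I"
  shows "(\<integral>\<^sup>+ W. ennreal (prod_tilt I c W) \<partial>(\<Pi>\<^sub>M i\<in>I. std_complex_gaussian)) = 1"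
proof -
  interpret prob_space "\<Pi>\<^sub>M i\<in>I. std_complex_gaussian"
    by (rule prob_space_PiM) (rule prob_space_std_complex_gaussian)
  show ?thesis
    using nn_integral_PiM_gaussian_shift[OF assms, of "\<lambda>_. 1" c] by (simp add: emeasure_space_1)
qed

lemma nn_integral_likelihood_ratio:
  "(\<integral>\<^sup>+ x. ennreal (likelihood_ratio n \<Delta> x) \<partial>noise n p) = 1"
proof -
  interpret B: prob_space "\<Pi>\<^sub>M jk\<in>upper_pairs n. measure_pmf (bernoulli_pmf p)"
    by (rule prob_space_PiM) (rule prob_space_measure_pmf)
  show ?thesis
    by (subst nn_integral_noise, measurable)
       (simp add: likelihood_ratio_def nn_integral_prod_tilt B.emeasure_space_1)
qed

text \<open>
  Given the edges, the square is a constant times another tilt, so only that constant remains: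
  a product over the edges, whose expectation factorises because the edges are independent.
\<close>

lemma nn_integral_likelihood_ratio_power2:
  assumes p: "0 \<le> p" "p \<le> 1"
  shows "(\<integral>\<^sup>+ x. ennreal ((likelihood_ratio n \<Delta> x)\<^sup>2) \<partial>noise n p) =
    ennreal (\<Prod>e\<in>upper_pairs n. 1 + p * (exp (2 * (cmod (\<Delta> e))\<^sup>2) - 1))"
proof -
  let ?G = "\<Pi>\<^sub>M jk\<in>upper_pairs n. std_complex_gaussian"
  let ?B = "\<Pi>\<^sub>M jk\<in>upper_pairs n. measure_pmf (bernoulli_pmf p)"
  interpret P: product_sigma_finite "\<lambda>_. measure_pmf (bernoulli_pmf p)" ..
  have "(\<integral>\<^sup>+ x. ennreal ((likelihood_ratio n \<Delta> x)\<^sup>2) \<partial>noise n p) =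
      (\<integral>\<^sup>+ B. \<integral>\<^sup>+ W. ennreal (exp (2 * (\<Sum>e\<in>upper_pairs n. (cmod (of_bool (B e) * \<Delta> e))\<^sup>2))) *
        ennreal (prod_tilt (upper_pairs n) (\<lambda>e. 2 * (of_bool (B e) * \<Delta> e)) W) \<partial>?G \<partial>?B)"
    by (subst nn_integral_noise, measurable) (simp add: likelihood_ratio_def prod_tilt_power2 ennreal_mult)
  also have "\<dots> = (\<integral>\<^sup>+ B. ennreal (exp (2 * (\<Sum>e\<in>upper_pairs n. (cmod (of_bool (B e) * \<Delta> e))\<^sup>2))) \<partial>?B)"
    by (subst nn_integral_cmult) (simp_all add: nn_integral_prod_tilt)
  also have "\<dots> = (\<integral>\<^sup>+ B. (\<Prod>e\<in>upper_pairs n. ennreal (exp (2 * (cmod (of_bool (B e) * \<Delta> e))\<^sup>2))) \<partial>?B)"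
    by (simp add: sum_distrib_left exp_sum prod_ennreal)
  also have "\<dots> = (\<Prod>e\<in>upper_pairs n. \<integral>\<^sup>+ b. ennreal (exp (2 * (cmod (of_bool b * \<Delta> e))\<^sup>2)) \<partial>bernoulli_pmf p)"
    by (rule P.product_nn_integral_prod) simp_all
  also have "\<dots> = (\<Prod>e\<in>upper_pairs n. ennreal (1 + p * (exp (2 * (cmod (\<Delta> e))\<^sup>2) - 1)))"
    using p by (intro prod.cong refl)
      (simp add: nn_integral_bernoulli_pmf algebra_simps flip: ennreal_mult ennreal_plus)
  also have "\<dots> = ennreal (\<Prod>e\<in>upper_pairs n. 1 + p * (exp (2 * (cmod (\<Delta> e))\<^sup>2) - 1))"
    using p by (intro prod_ennreal) simp
  finally show ?thesis .
qed

section \<open>An information inequality on the circle\<close>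

text \<open>
  The van Trees inequality on the circle, in finite-difference form. The index \<open>z\<close> runs over the
  support of a uniform prior, \<open>X z\<close> is the rotation between an estimate and the true angle, and
  \<open>R z\<close> is the likelihood ratio for a shift that turns the true angle by \<open>2 * h\<close>; hypothesis \<open>shift\<close> is the
  invariance of the prior under it. To first order in \<open>h\<close>, the correlation of \<open>Im (X z)\<close>
  with \<open>R z - 1\<close> is \<open>2 * h * c\<close>, while the mean of \<open>(Im (X z))\<^sup>2\<close> is at most \<open>1 - c\<^sup>2\<close>; Cauchy-Schwarz
  gives \<open>4 * h\<^sup>2 * c\<^sup>2 \<le> (1 - c\<^sup>2) * \<kappa>\<close>. The term \<open>2 * \<bar>sin h\<bar>\<close> pays for a
  rotation of \<open>X z\<close> by \<open>cis (- h)\<close>, which makes the first correlation exactly \<open>2 * sin h * c\<close>.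
\<close>

lemma (in prob_space) circular_information_inequality:
  fixes X :: "'z \<Rightarrow> 'a \<Rightarrow> complex" and R :: "'z \<Rightarrow> 'a \<Rightarrow> real"
  assumes Z: "finite Z" "Z \<noteq> {}"
    and X_meas [measurable]: "\<And>z. z \<in> Z \<Longrightarrow> X z \<in> borel_measurable M"
    and X_norm: "\<And>z x. z \<in> Z \<Longrightarrow> x \<in> space M \<Longrightarrow> cmod (X z x) = 1"
    and R_meas [measurable]: "\<And>z. z \<in> Z \<Longrightarrow> R z \<in> borel_measurable M"
    and R_int: "\<And>z. z \<in> Z \<Longrightarrow> integrable M (\<lambda>x. (R z x)\<^sup>2)"
    and R_mean: "\<And>z. z \<in> Z \<Longrightarrow> expectation (R z) = 1"
    and R_sq: "\<And>z. z \<in> Z \<Longrightarrow> expectation (\<lambda>x. (R z x)\<^sup>2) \<le> 1 + \<kappa>"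
    and \<kappa>: "\<kappa> > 0"
    and shift: "(\<Sum>z\<in>Z. expectation (X z)) = cis (-2 * h) * (\<Sum>z\<in>Z. expectation (\<lambda>x. R z x *\<^sub>R X z x))"
  defines "c \<equiv> (\<Sum>z\<in>Z. expectation (\<lambda>x. Re (X z x))) / card Z"
  shows "c\<^sup>2 * (4 * (sin h)\<^sup>2 + \<kappa>) \<le> (1 + 2 * \<bar>sin h\<bar>) * \<kappa>"
proof -
  define N where "N = real (card Z)"
  have N: "N > 0"
    using Z by (simp add: N_def card_gt_0_iff)
  have sum_Re: "(\<Sum>z\<in>Z. expectation (\<lambda>x. Re (X z x))) = N * c"
    using N by (simp add: c_def N_def)
  have R_int1: "integrable M (R z)" if "z \<in> Z" for z
    using R_int[OF that] R_meas[OF that] by (rule square_integrable_imp_integrable[rotated])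
  have X_int: "integrable M (X z)" if "z \<in> Z" for z
    using that X_norm by (intro integrable_const_bound[of _ 1]) auto
  have RX_int: "integrable M (\<lambda>x. R z x *\<^sub>R X z x)" if "z \<in> Z" for z
    by (rule Bochner_Integration.integrable_bound[OF R_int1[OF that]])
       (use that X_norm in auto)
  define Y where "Y z x = Im (X z x * cis (- h))" for z x
  have Y_meas [measurable]: "Y z \<in> borel_measurable M" if "z \<in> Z" for z
    using that unfolding Y_def by measurable
  have X_split: "\<bar>Re (X z x)\<bar> \<le> 1" "\<bar>Im (X z x)\<bar> \<le> 1" "(Re (X z x))\<^sup>2 + (Im (X z x))\<^sup>2 = 1"
    if "z \<in> Z" "x \<in> space M" for z x
    using X_norm[OF that] abs_Re_le_cmod[of "X z x"] abs_Im_le_cmod[of "X z x"]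
    by (auto simp: cmod_power2[symmetric])
  have Y_abs: "\<bar>Y z x\<bar> \<le> 1" if "z \<in> Z" "x \<in> space M" for z x
    using abs_Im_le_cmod[of "X z x * cis (- h)"] X_norm[OF that] by (simp add: Y_def norm_mult)
  have Y_sq: "(Y z x)\<^sup>2 \<le> 1 - (Re (X z x))\<^sup>2 + 2 * \<bar>sin h\<bar>" if "z \<in> Z" "x \<in> space M" for z x
  proof -
    define a b where "a = Re (X z x)" and "b = Im (X z x)"
    have ab: "\<bar>a\<bar> \<le> 1" "\<bar>b\<bar> \<le> 1" "a\<^sup>2 + b\<^sup>2 = 1"
      using X_split[OF that] by (auto simp: a_def b_def)
    have "(Y z x)\<^sup>2 = (b * cos h - a * sin h)\<^sup>2"
      by (simp add: Y_def a_def b_def)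
    also have "\<dots> = b\<^sup>2 * (cos h)\<^sup>2 + a\<^sup>2 * (sin h)\<^sup>2 - 2 * (a * b * cos h) * sin h"
      by (simp add: power2_eq_square algebra_simps)
    also have "\<dots> = b\<^sup>2 + (a\<^sup>2 - b\<^sup>2) * (sin h)\<^sup>2 - 2 * (a * b * cos h) * sin h"
      by (simp add: cos_squared_eq algebra_simps)
    also have "\<dots> = b\<^sup>2 + ((a\<^sup>2 - b\<^sup>2) * sin h - 2 * a * b * cos h) * sin h"
      by (simp add: power2_eq_square algebra_simps)
    also have "\<dots> \<le> b\<^sup>2 + 2 * \<bar>sin h\<bar>"
    proof -
      have "\<bar>a\<^sup>2 - b\<^sup>2\<bar> \<le> 1"
        using ab(3) zero_le_power2[of a] zero_le_power2[of b] by linarith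
      then have 1: "\<bar>(a\<^sup>2 - b\<^sup>2) * sin h\<bar> \<le> 1"
        by (simp add: abs_mult mult_le_one)
      have "2 * \<bar>a * b\<bar> \<le> 1"
        using ab(3) zero_le_power2[of "\<bar>a\<bar> - \<bar>b\<bar>"] by (simp add: power2_diff abs_mult)
      then have "\<bar>2 * a * b\<bar> * \<bar>cos h\<bar> \<le> 1"
        by (intro mult_le_one) (auto simp: abs_mult)
      then have "\<bar>(a\<^sup>2 - b\<^sup>2) * sin h - 2 * a * b * cos h\<bar> \<le> 2"
        using 1 abs_triangle_ineq4[of "(a\<^sup>2 - b\<^sup>2) * sin h" "2 * a * b * cos h"]
        by (simp add: abs_mult)
      then have "\<bar>((a\<^sup>2 - b\<^sup>2) * sin h - 2 * a * b * cos h) * sin h\<bar> \<le> 2 * \<bar>sin h\<bar>"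
        unfolding abs_mult[of _ "sin h"] by (rule mult_right_mono) simp
      then show ?thesis
        by linarith
    qed
    finally show ?thesis
      using ab(3) by (simp add: a_def)
  qed
  have Y2_int: "integrable M (\<lambda>x. (Y z x)\<^sup>2)" if "z \<in> Z" for z
    using that Y_abs by (intro integrable_const_bound[of _ 1]) (auto simp: abs_square_le_1)
  have YR_int: "integrable M (\<lambda>x. Y z x * (R z x - 1))" if "z \<in> Z" for z
  proof (rule Bochner_Integration.integrable_bound)
    show "integrable M (\<lambda>x. R z x - 1)"
      using R_int1[OF that] by simp
    show "AE x in M. norm (Y z x * (R z x - 1)) \<le> norm (R z x - 1)"
    proof (rule AE_I2)
      fix x assume "x \<in> space M"
      from Y_abs[OF that this] show "norm (Y z x * (R z x - 1)) \<le> norm (R z x - 1)"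
        by (simp add: abs_mult mult_left_le_one_le)
    qed
  qed (use that in measurable)
  have Re_int: "integrable M (\<lambda>x. Re (X z x))" "integrable M (\<lambda>x. (Re (X z x))\<^sup>2)" if "z \<in> Z" for z
    using that X_split by (auto intro!: integrable_const_bound[of _ 1] simp: abs_square_le_1)
  \<comment> \<open>rotating by \<open>cis (- h)\<close> symmetrises the shift: \<open>cis (2 * h) - 1\<close> becomes \<open>2 * \<i> * sin h\<close>\<close>
  have score: "(\<Sum>z\<in>Z. expectation (\<lambda>x. Y z x * (R z x - 1))) = 2 * sin h * (N * c)"
  proof -
    have "expectation (\<lambda>x. Y z x * (R z x - 1)) =
        Im (cis (- h) * (expectation (\<lambda>x. R z x *\<^sub>R X z x) - expectation (X z)))" if "z \<in> Z" for z
    proof -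
      have "cis (- h) * (expectation (\<lambda>x. R z x *\<^sub>R X z x) - expectation (X z)) =
          expectation (\<lambda>x. cis (- h) * (R z x *\<^sub>R X z x - X z x))"
        using RX_int[OF that] X_int[OF that] by simp
      also have "Im \<dots> = expectation (\<lambda>x. Im (cis (- h) * (R z x *\<^sub>R X z x - X z x)))"
        using RX_int[OF that] X_int[OF that] by (intro integral_Im[symmetric]) auto
      also have "\<dots> = expectation (\<lambda>x. Y z x * (R z x - 1))"
        by (rule Bochner_Integration.integral_cong) (auto simp: Y_def algebra_simps)
      finally show ?thesis
        by simp
    qed
    then have "(\<Sum>z\<in>Z. expectation (\<lambda>x. Y z x * (R z x - 1))) =
        Im (cis (- h) * ((\<Sum>z\<in>Z. expectation (\<lambda>x. R z x *\<^sub>R X z x)) - (\<Sum>z\<in>Z. expectation (X z))))"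
      by (simp add: sum_subtractf sum_distrib_left right_diff_distrib)
    also have "(\<Sum>z\<in>Z. expectation (\<lambda>x. R z x *\<^sub>R X z x)) = cis (2 * h) * (\<Sum>z\<in>Z. expectation (X z))"
      by (simp add: shift mult.assoc[symmetric] cis_mult)
    also have "cis (- h) * (cis (2 * h) * (\<Sum>z\<in>Z. expectation (X z)) - (\<Sum>z\<in>Z. expectation (X z))) =
        (cis h - cis (- h)) * (\<Sum>z\<in>Z. expectation (X z))"
      by (simp add: algebra_simps cis_mult mult.assoc[symmetric])
    also have "Im \<dots> = 2 * sin h * Re (\<Sum>z\<in>Z. expectation (X z))"
      by simp
    also have "Re (\<Sum>z\<in>Z. expectation (X z)) = N * c"
      using X_int by (simp add: sum_Re[symmetric] integral_Re)
    finally show ?thesis .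
  qed
  have sum_Y: "(\<Sum>z\<in>Z. expectation (\<lambda>x. (Y z x)\<^sup>2)) \<le> N * (1 - c\<^sup>2 + 2 * \<bar>sin h\<bar>)"
  proof -
    have "expectation (\<lambda>x. (Y z x)\<^sup>2) \<le> 1 + c\<^sup>2 + 2 * \<bar>sin h\<bar> - 2 * c * expectation (\<lambda>x. Re (X z x))"
      if "z \<in> Z" for z
    proof -
      have "expectation (\<lambda>x. (Y z x)\<^sup>2) \<le>
          expectation (\<lambda>x. 1 + c\<^sup>2 + 2 * \<bar>sin h\<bar> - 2 * c * Re (X z x))"
      proof (rule integral_mono[OF Y2_int[OF that]])
        fix x assume x: "x \<in> space M"
        show "(Y z x)\<^sup>2 \<le> 1 + c\<^sup>2 + 2 * \<bar>sin h\<bar> - 2 * c * Re (X z x)"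
          using Y_sq[OF that x] zero_le_power2[of "Re (X z x) - c"] by (simp add: power2_diff mult.assoc mult.left_commute mult.commute)
      qed (use Re_int[OF that] in auto)
      also have "\<dots> = 1 + c\<^sup>2 + 2 * \<bar>sin h\<bar> - 2 * c * expectation (\<lambda>x. Re (X z x))"
        using Re_int[OF that] by (simp add: prob_space)
      finally show ?thesis .
    qed
    then have "(\<Sum>z\<in>Z. expectation (\<lambda>x. (Y z x)\<^sup>2)) \<le>
        (\<Sum>z\<in>Z. 1 + c\<^sup>2 + 2 * \<bar>sin h\<bar> - 2 * c * expectation (\<lambda>x. Re (X z x)))"
      by (rule sum_mono)
    also have "\<dots> = N * (1 + c\<^sup>2 + 2 * \<bar>sin h\<bar>) - 2 * c * (N * c)"
      by (simp add: sum_subtractf sum_distrib_left[symmetric] sum_Re N_def)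
    also have "\<dots> = N * (1 - c\<^sup>2 + 2 * \<bar>sin h\<bar>)"
      by (simp add: power2_eq_square algebra_simps)
    finally show ?thesis .
  qed
  \<comment> \<open>the minimiser of the quadratic in \<open>r\<close> below, so that its nonnegativity is Cauchy-Schwarz\<close>
  define r where "r = 2 * sin h * c / \<kappa>"
  have "0 \<le> N * (1 - c\<^sup>2 + 2 * \<bar>sin h\<bar>) - 2 * r * (2 * sin h * (N * c)) + r\<^sup>2 * (N * \<kappa>)"
  proof -
    have R1: "expectation (\<lambda>x. (R z x - 1)\<^sup>2) \<le> \<kappa>" if "z \<in> Z" for z
    proof -
      have "expectation (\<lambda>x. (R z x - 1)\<^sup>2) = expectation (\<lambda>x. (R z x)\<^sup>2 - 2 * R z x + 1)"
        by (rule Bochner_Integration.integral_cong) (auto simp: power2_eq_square algebra_simps)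
      also have "\<dots> = expectation (\<lambda>x. (R z x)\<^sup>2) - 1"
        using R_int[OF that] R_int1[OF that] by (simp add: R_mean[OF that] prob_space)
      finally show ?thesis
        using R_sq[OF that] by simp
    qed
    have R1_int: "integrable M (\<lambda>x. (R z x - 1)\<^sup>2)" if "z \<in> Z" for z
      using R_int[OF that] R_int1[OF that] by (simp add: power2_diff)
    have "0 \<le> expectation (\<lambda>x. (Y z x)\<^sup>2) - 2 * r * expectation (\<lambda>x. Y z x * (R z x - 1)) + r\<^sup>2 * \<kappa>"
      if "z \<in> Z" for z
    proof -
      have "0 \<le> expectation (\<lambda>x. (Y z x - r * (R z x - 1))\<^sup>2)"
        by (rule Bochner_Integration.integral_nonneg) simp
      also have "\<dots> = expectation (\<lambda>x. (Y z x)\<^sup>2 - 2 * r * (Y z x * (R z x - 1)) + r\<^sup>2 * (R z x - 1)\<^sup>2)"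
        by (rule Bochner_Integration.integral_cong) (auto simp: power2_eq_square algebra_simps)
      also have "\<dots> = expectation (\<lambda>x. (Y z x)\<^sup>2) - 2 * r * expectation (\<lambda>x. Y z x * (R z x - 1)) +
          r\<^sup>2 * expectation (\<lambda>x. (R z x - 1)\<^sup>2)"
        by (simp add: Y2_int[OF that] YR_int[OF that] R1_int[OF that] del: mult_minus_right
            mult.assoc)
      also have "\<dots> \<le> expectation (\<lambda>x. (Y z x)\<^sup>2) - 2 * r * expectation (\<lambda>x. Y z x * (R z x - 1)) + r\<^sup>2 * \<kappa>"
        using R1[OF that] by (simp add: mult_left_mono)
      finally show ?thesis .
    qed
    then have "0 \<le> (\<Sum>z\<in>Z. expectation (\<lambda>x. (Y z x)\<^sup>2) -
        2 * r * expectation (\<lambda>x. Y z x * (R z x - 1)) + r\<^sup>2 * \<kappa>)"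
      by (rule sum_nonneg)
    also have "\<dots> = (\<Sum>z\<in>Z. expectation (\<lambda>x. (Y z x)\<^sup>2)) -
        2 * r * (\<Sum>z\<in>Z. expectation (\<lambda>x. Y z x * (R z x - 1))) + r\<^sup>2 * (N * \<kappa>)"
      by (simp add: sum.distrib sum_subtractf sum_distrib_left N_def)
    finally show ?thesis
      using sum_Y unfolding score by linarith
  qed
  also have "\<dots> = N / \<kappa> * ((1 - c\<^sup>2 + 2 * \<bar>sin h\<bar>) * \<kappa> - 4 * (sin h)\<^sup>2 * c\<^sup>2)"
    using \<kappa> by (simp add: r_def field_simps power2_eq_square)
  finally have "0 \<le> (1 - c\<^sup>2 + 2 * \<bar>sin h\<bar>) * \<kappa> - 4 * (sin h)\<^sup>2 * c\<^sup>2"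
    using divide_pos_pos[OF N \<kappa>] unfolding zero_le_mult_iff by linarith
  then show ?thesis
    by (simp add: algebra_simps)
qed

section \<open>Rotating two phases\<close>

lemma cmod_diff_unit:
  assumes "cmod a = 1" "cmod b = 1"
  shows "(cmod (a - b))\<^sup>2 = 2 - 2 * Re (a * cnj b)"
proof -
  have "(cmod (a - b))\<^sup>2 = (cmod a)\<^sup>2 + (cmod b)\<^sup>2 - 2 * Re (a * cnj b)"
    by (simp add: cmod_power2 power2_diff algebra_simps)
  with assms show ?thesis
    by simp
qed

text \<open>
  The squared Frobenius distance of the rank-one matrices \<open>u u\<^sup>*\<close> and \<open>v v\<^sup>*\<close>. It is used twice: for
  an estimate and the truth, and for \<open>v = 1\<close> to add up the information of a rotation over all edges.
\<close>

lemma sum_cmod_pair_diff: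
  fixes u v :: "'i \<Rightarrow> complex"
  assumes "\<And>i. i \<in> I \<Longrightarrow> cmod (u i) = 1" "\<And>i. i \<in> I \<Longrightarrow> cmod (v i) = 1"
  shows "(\<Sum>i\<in>I. \<Sum>j\<in>I. (cmod (u i * cnj (u j) - v i * cnj (v j)))\<^sup>2) =
    2 * (real (card I))\<^sup>2 - 2 * (cmod (\<Sum>i\<in>I. u i * cnj (v i)))\<^sup>2"
proof -
  have "(cmod (u i * cnj (u j) - v i * cnj (v j)))\<^sup>2 = 2 - 2 * Re (u i * cnj (v i) * cnj (u j * cnj (v j)))"
    if "i \<in> I" "j \<in> I" for i j
  proof -
    have "cmod (u i * cnj (u j)) = 1" "cmod (v i * cnj (v j)) = 1"
      using assms that by (simp_all add: norm_mult)
    then have "(cmod (u i * cnj (u j) - v i * cnj (v j)))\<^sup>2 =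
        2 - 2 * Re (u i * cnj (u j) * cnj (v i * cnj (v j)))"
      by (rule cmod_diff_unit)
    then show ?thesis
      by (simp only: complex_cnj_mult complex_cnj_cnj ac_simps)
  qed
  then have "(\<Sum>i\<in>I. \<Sum>j\<in>I. (cmod (u i * cnj (u j) - v i * cnj (v j)))\<^sup>2) =
      (\<Sum>i\<in>I. \<Sum>j\<in>I. 2 - 2 * Re (u i * cnj (v i) * cnj (u j * cnj (v j))))"
    by simp
  also have "\<dots> = 2 * (real (card I))\<^sup>2 -
      2 * Re ((\<Sum>i\<in>I. u i * cnj (v i)) * cnj (\<Sum>i\<in>I. u i * cnj (v i)))"
    unfolding cnj_sum sum_product
    by (simp add: sum_subtractf sum_distrib_left power2_eq_square del: cnj_sum complex_cnj_mult)
  also have "Re ((\<Sum>i\<in>I. u i * cnj (v i)) * cnj (\<Sum>i\<in>I. u i * cnj (v i))) =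
      (cmod (\<Sum>i\<in>I. u i * cnj (v i)))\<^sup>2"
    by (simp add: complex_norm_square[symmetric] del: cnj_sum)
  finally show ?thesis .
qed

text \<open>
  The support of the prior. Roots of unity form a finite group, so this set is invariant under turns
  by its own elements.
\<close>

definition grid :: "nat \<Rightarrow> nat \<Rightarrow> (nat \<Rightarrow> complex) set" where
  "grid n m = {..<n} \<rightarrow>\<^sub>E {w. w ^ m = 1}"

lemma finite_grid [simp]: "m > 0 \<Longrightarrow> finite (grid n m)"
  by (auto simp: grid_def intro!: finite_PiE finite_roots_unity)

lemma grid_nonempty [simp]: "m > 0 \<Longrightarrow> grid n m \<noteq> {}"
  by (auto simp: grid_def PiE_eq_empty_iff intro!: exI[of _ 1])

lemma cmod_grid: "z \<in> grid n m \<Longrightarrow> m > 0 \<Longrightarrow> i < n \<Longrightarrow> cmod (z i) = 1"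
  by (auto simp: grid_def dest!: PiE_mem dest: power_eq_1_iff)

definition rotate_phases :: "nat \<Rightarrow> (nat \<Rightarrow> complex) \<Rightarrow> (nat \<Rightarrow> complex) \<Rightarrow> nat \<Rightarrow> complex" where
  "rotate_phases n f z = (\<lambda>i\<in>{..<n}. f i * z i)"

lemma rotate_phases_grid:
  assumes "\<And>i. i < n \<Longrightarrow> f i ^ m = 1" "z \<in> grid n m"
  shows "rotate_phases n f z \<in> grid n m"
  using assms unfolding rotate_phases_def grid_def by (intro restrict_PiE_iff[THEN iffD2]) (auto simp: PiE_iff power_mult_distrib)

lemma rotate_phases_cancel:
  assumes "\<And>i. i < n \<Longrightarrow> g i * f i = 1" "z \<in> grid n m"
  shows "rotate_phases n g (rotate_phases n f z) = z"
proof
  fix i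
  show "rotate_phases n g (rotate_phases n f z) i = z i"
    using assms(1)[of i] PiE_arb[OF assms(2)[unfolded grid_def], of i]
    by (cases "i < n") (simp_all add: rotate_phases_def flip: mult.assoc)
qed

lemma bij_betw_rotate_phases:
  assumes "m > 0" and f: "\<And>i. i < n \<Longrightarrow> f i ^ m = 1"
  shows "bij_betw (rotate_phases n f) (grid n m) (grid n m)"
proof -
  have nz: "f i \<noteq> 0" if "i < n" for i
    using f[OF that] \<open>m > 0\<close> by (auto simp: power_0_left)
  have "rotate_phases n f ` grid n m \<subseteq> grid n m"
    using rotate_phases_grid[of n f m] f by blast
  moreover have "rotate_phases n (\<lambda>i. inverse (f i)) ` grid n m \<subseteq> grid n m"
    using rotate_phases_grid[of n "\<lambda>i. inverse (f i)" m] f by (auto simp: power_inverse)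
  moreover have "rotate_phases n (\<lambda>i. inverse (f i)) (rotate_phases n f z) = z"
      "rotate_phases n f (rotate_phases n (\<lambda>i. inverse (f i)) z) = z" if "z \<in> grid n m" for z
    using nz that by (intro rotate_phases_cancel; simp)+
  ultimately show ?thesis
    by (intro bij_betw_byWitness[where f' = "rotate_phases n (\<lambda>i. inverse (f i))"] ballI)
qed

lemma sum_upper_pairs_le:
  fixes D :: "nat \<Rightarrow> nat \<Rightarrow> real"
  assumes sym: "\<And>a b. D a b = D b a" and nonneg: "\<And>a b. 0 \<le> D a b"
  shows "2 * (\<Sum>(a, b)\<in>upper_pairs n. D a b) \<le> (\<Sum>a<n. \<Sum>b<n. D a b)"
proof -
  let ?L = "(\<lambda>(a, b). (b, a)) ` upper_pairs n"
  have "(\<Sum>(a, b)\<in>?L. D a b) = (\<Sum>(a, b)\<in>upper_pairs n. D a b)"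
    by (subst sum.reindex) (auto simp: inj_on_def case_prod_unfold sym intro!: sum.cong)
  then have "2 * (\<Sum>(a, b)\<in>upper_pairs n. D a b) = (\<Sum>(a, b)\<in>upper_pairs n \<union> ?L. D a b)"
    by (subst sum.union_disjoint) (use finite_upper_pairs[of n] in \<open>auto simp: upper_pairs_def\<close>)
  also have "\<dots> \<le> (\<Sum>(a, b)\<in>{..<n} \<times> {..<n}. D a b)"
    by (rule sum_mono2) (auto simp: upper_pairs_def nonneg)
  finally show ?thesis
    by (simp add: sum.cartesian_product)
qed

text \<open>
  This direction in the torus is the least favourable one for the relative phase of \<open>j\<close> and \<open>k\<close>.
  Turning \<open>z\<^sub>j\<close> alone would give information about \<open>2 n p / \<sigma>\<^sup>2\<close> per unit change of the relative phase,
  turning both in opposite senses only half of that.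
\<close>

definition opposite_turn :: "real \<Rightarrow> nat \<Rightarrow> nat \<Rightarrow> nat \<Rightarrow> complex" where
  "opposite_turn h j k i = (if i = j then cis h else if i = k then cis (- h) else 1)"

lemma cmod_opposite_turn [simp]: "cmod (opposite_turn h j k i) = 1"
  by (simp add: opposite_turn_def)

lemma opposite_turn_pair_le:
  "(cmod (opposite_turn h j k a * cnj (opposite_turn h j k b) - 1))\<^sup>2 \<le> 4 * (2 - 2 * cos h)"
proof -
  let ?f = "opposite_turn h j k"
  have 1: "(cmod (cis t - 1))\<^sup>2 = 2 - 2 * cos t" for t
    by (simp add: cmod_power2 power2_diff sin_squared_eq)
  have f1: "cmod (?f i - 1) \<le> cmod (cis h - 1)" for i
  proof -
    have "(cmod (cis (- h) - 1))\<^sup>2 = (cmod (cis h - 1))\<^sup>2"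
      by (simp only: 1 cos_minus)
    then show ?thesis
      by (simp add: opposite_turn_def)
  qed
  have "?f a * cnj (?f b) - 1 = (?f a - ?f b) * cnj (?f b)"
    using complex_norm_square[of "?f b"] by (simp add: left_diff_distrib)
  then have "cmod (?f a * cnj (?f b) - 1) = cmod ((?f a - 1) - (?f b - 1))"
    by (simp add: norm_mult)
  also have "\<dots> \<le> 2 * cmod (cis h - 1)"
    using norm_triangle_ineq4[of "?f a - 1" "?f b - 1"] f1[of a] f1[of b] by linarith
  finally have "(cmod (?f a * cnj (?f b) - 1))\<^sup>2 \<le> (2 * cmod (cis h - 1))\<^sup>2"
    by (rule power_mono) simp
  then show ?thesis
    by (simp add: power_mult_distrib 1)
qed

text \<open>
  Instead of a case distinction on the edges: the Frobenius identity reduces the double sum to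
  \<open>\<Sum>i<n. opposite_turn h j k i = n - (2 - 2 * cos h)\<close>.
\<close>

lemma sum_opposite_turn_le:
  assumes "j < n" "k < n" "j \<noteq> k"
  shows "(\<Sum>(a, b)\<in>upper_pairs n. (cmod (opposite_turn h j k a * cnj (opposite_turn h j k b) - 1))\<^sup>2)
    \<le> 2 * real n * (2 - 2 * cos h)"
proof -
  let ?f = "opposite_turn h j k"
  \<comment> \<open>\<open>q = |cis h - 1|\<^sup>2\<close>\<close>
  define q where "q = 2 - 2 * cos h"
  have "2 * (\<Sum>(a, b)\<in>upper_pairs n. (cmod (?f a * cnj (?f b) - 1))\<^sup>2) \<le>
      (\<Sum>a<n. \<Sum>b<n. (cmod (?f a * cnj (?f b) - 1))\<^sup>2)"
  proof (rule sum_upper_pairs_le)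
    show "(cmod (?f a * cnj (?f b) - 1))\<^sup>2 = (cmod (?f b * cnj (?f a) - 1))\<^sup>2" for a b
      using complex_mod_cnj[of "?f a * cnj (?f b) - 1"] by (simp add: mult.commute)
  qed simp
  also have "\<dots> = 2 * (real n)\<^sup>2 - 2 * (cmod (\<Sum>i<n. ?f i))\<^sup>2"
    using sum_cmod_pair_diff[of "{..<n}" ?f "\<lambda>_. 1"] by simp
  also have "(\<Sum>i<n. ?f i) = of_real (real n - q)"
  proof -
    have "(\<Sum>i<n. ?f i) = (\<Sum>i<n. 1 + (if i = j then cis h - 1 else 0) + (if i = k then cis (- h) - 1 else 0))"
      using assms(3) by (intro sum.cong) (auto simp: opposite_turn_def)
    also have "\<dots> = of_nat n + (cis h - 1) + (cis (- h) - 1)"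
      using assms by (simp add: sum.distrib)
    also have "\<dots> = of_real (real n - q)"
      by (simp add: complex_eq_iff q_def)
    finally show ?thesis .
  qed
  also have "2 * (real n)\<^sup>2 - 2 * (cmod (of_real (real n - q)))\<^sup>2 = 4 * real n * q - 2 * q\<^sup>2"
    unfolding norm_of_real by (simp add: power2_eq_square algebra_simps)
  also have "\<dots> \<le> 4 * real n * q"
    by simp
  finally show ?thesis
    by (simp add: q_def)
qed

text \<open>
  An upper bound for the variance of the likelihood ratio, and to leading order \<open>4 n p h\<^sup>2 / \<sigma>\<^sup>2\<close> as
  \<open>h\<close> tends to \<open>0\<close>; the inner exponential tends to \<open>1\<close>.
\<close>

definition chi_square_bound :: "nat \<Rightarrow> real \<Rightarrow> real \<Rightarrow> real \<Rightarrow> real" where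
  "chi_square_bound n p \<sigma> h =
     exp (4 * real n * p / \<sigma>\<^sup>2 * (2 - 2 * cos h) * exp (8 / \<sigma>\<^sup>2 * (2 - 2 * cos h))) - 1"

text \<open>
  Bounding \<open>1 + x\<close> by \<open>exp x\<close> turns the product into a sum of displacements, and bounding
  \<open>exp x - 1\<close> by \<open>x * exp x\<close> makes that sum linear in the squared displacements, whose total is known;
  both steps are sharp to leading order in \<open>h\<close>.
\<close>

lemma likelihood_ratio_turn_le:
  assumes "0 \<le> p" "\<sigma> > 0" and jk: "j < n" "k < n" "j \<noteq> k"
    and z: "\<And>i. i < n \<Longrightarrow> cmod (z i) = 1"
  shows "(\<Prod>e\<in>upper_pairs n. 1 + p * (exp (2 * (cmod (drift \<sigma> z (rotate_phases n (opposite_turn h j k) z) e))\<^sup>2) - 1))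
    \<le> 1 + chi_square_bound n p \<sigma> h"
proof -
  let ?f = "opposite_turn h j k"
  define q where "q = 2 - 2 * cos h"
  define D where "D = (\<lambda>(a, b). (cmod (?f a * cnj (?f b) - 1))\<^sup>2)"
  have drift: "(cmod (drift \<sigma> z (rotate_phases n ?f z) e))\<^sup>2 = D e / \<sigma>\<^sup>2" if "e \<in> upper_pairs n" for e
  proof (cases e)
    case (Pair a b)
    with that have ab: "a < n" "b < n"
      by (auto simp: upper_pairs_def)
    have "?f a * z a * cnj (?f b * z b) - z a * cnj (z b) = (?f a * cnj (?f b) - 1) * (z a * cnj (z b))"
      by (simp add: algebra_simps)
    then show ?thesis
      using ab z[OF ab(1)] z[OF ab(2)] \<open>\<sigma> > 0\<close>
      by (simp add: Pair drift_def rotate_phases_def D_def norm_divide norm_mult power_divide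
          del: complex_cnj_mult)
  qed
  have exp_le: "exp x - 1 \<le> x * exp x" for x :: real
    using exp_ge_add_one_self[of "- x"] mult_right_mono[of "1 - x" "exp (- x)" "exp x"]
    by (simp add: left_diff_distrib flip: exp_add)
  have "(\<Prod>e\<in>upper_pairs n. 1 + p * (exp (2 * (cmod (drift \<sigma> z (rotate_phases n ?f z) e))\<^sup>2) - 1)) \<le>
      (\<Prod>e\<in>upper_pairs n. exp (p * (2 / \<sigma>\<^sup>2 * exp (8 / \<sigma>\<^sup>2 * q)) * D e))"
  proof (rule prod_mono)
    fix e assume e: "e \<in> upper_pairs n"
    have D: "0 \<le> D e" "D e \<le> 4 * q"
      using opposite_turn_pair_le[of h j k "fst e" "snd e"] by (auto simp: D_def q_def case_prod_unfold)
    have "exp (2 * D e / \<sigma>\<^sup>2) - 1 \<le> 2 * D e / \<sigma>\<^sup>2 * exp (2 * D e / \<sigma>\<^sup>2)"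
      by (rule exp_le)
    also have "\<dots> \<le> 2 * D e / \<sigma>\<^sup>2 * exp (8 / \<sigma>\<^sup>2 * q)"
      using D by (intro mult_left_mono) (auto simp: divide_right_mono)
    finally have "p * (exp (2 * D e / \<sigma>\<^sup>2) - 1) \<le> p * (2 / \<sigma>\<^sup>2 * exp (8 / \<sigma>\<^sup>2 * q)) * D e"
      using \<open>0 \<le> p\<close> by (auto dest: mult_left_mono[of _ _ p] simp: mult_ac)
    then have "1 + p * (exp (2 * D e / \<sigma>\<^sup>2) - 1) \<le> exp (p * (2 / \<sigma>\<^sup>2 * exp (8 / \<sigma>\<^sup>2 * q)) * D e)"
      using exp_ge_add_one_self[of "p * (2 / \<sigma>\<^sup>2 * exp (8 / \<sigma>\<^sup>2 * q)) * D e"] by linarith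
    moreover have "0 \<le> p * (exp (2 * D e / \<sigma>\<^sup>2) - 1)"
      using \<open>0 \<le> p\<close> D by simp
    ultimately show "0 \<le> 1 + p * (exp (2 * (cmod (drift \<sigma> z (rotate_phases n ?f z) e))\<^sup>2) - 1) \<and>
        1 + p * (exp (2 * (cmod (drift \<sigma> z (rotate_phases n ?f z) e))\<^sup>2) - 1)
        \<le> exp (p * (2 / \<sigma>\<^sup>2 * exp (8 / \<sigma>\<^sup>2 * q)) * D e)"
      by (simp add: drift[OF e])
  qed
  also have "\<dots> = exp (p * (2 / \<sigma>\<^sup>2 * exp (8 / \<sigma>\<^sup>2 * q)) * (\<Sum>e\<in>upper_pairs n. D e))"
    by (simp add: exp_sum sum_distrib_left)
  also have "\<dots> \<le> exp (p * (2 / \<sigma>\<^sup>2 * exp (8 / \<sigma>\<^sup>2 * q)) * (2 * real n * q))"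
    using sum_opposite_turn_le[OF jk, of h] \<open>0 \<le> p\<close>
    by (intro exp_mono mult_left_mono) (auto simp: D_def q_def)
  also have "\<dots> = 1 + chi_square_bound n p \<sigma> h"
    by (simp add: chi_square_bound_def q_def mult_ac)
  finally show ?thesis .
qed

section \<open>Lower bound for the estimation of one relative phase\<close>

lemma expectation_change:
  fixes T :: "(nat \<times> nat \<Rightarrow> bool) \<times> (nat \<times> nat \<Rightarrow> complex) \<Rightarrow> complex"
  assumes "\<sigma> > 0" and [measurable]: "T \<in> borel_measurable (data_space n)"
  shows "(\<integral>x. T (observed_data n \<sigma> z' x) \<partial>noise n p) =
    (\<integral>x. likelihood_ratio n (drift \<sigma> z z') x *\<^sub>R T (observed_data n \<sigma> z x) \<partial>noise n p)"
proof -
  let ?D = "density (noise n p) (\<lambda>x. ennreal (likelihood_ratio n (drift \<sigma> z z') x))"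
  have nonneg: "0 \<le> likelihood_ratio n (drift \<sigma> z z') x" for x
    by (simp add: likelihood_ratio_def case_prod_unfold)
  have "(\<integral>x. T (observed_data n \<sigma> z' x) \<partial>noise n p) = (\<integral>d. T d \<partial>data_law n p \<sigma> z')"
    unfolding data_law_def by (rule integral_distr[symmetric]) measurable
  also have "\<dots> = (\<integral>x. T (observed_data n \<sigma> z x) \<partial>?D)"
    unfolding data_law_change[OF assms(1), of n p z' z] by (rule integral_distr) measurable
  also have "\<dots> = (\<integral>x. likelihood_ratio n (drift \<sigma> z z') x *\<^sub>R T (observed_data n \<sigma> z x) \<partial>noise n p)"
    by (rule integral_density) (auto simp: nonneg)
  finally show ?thesis .
qed

lemma likelihood_ratio_moments:
  assumes p: "0 \<le> p" "p \<le> 1"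
  shows "(\<integral>x. likelihood_ratio n \<Delta> x \<partial>noise n p) = 1"
    and "integrable (noise n p) (\<lambda>x. (likelihood_ratio n \<Delta> x)\<^sup>2)"
    and "(\<integral>x. (likelihood_ratio n \<Delta> x)\<^sup>2 \<partial>noise n p) =
      (\<Prod>e\<in>upper_pairs n. 1 + p * (exp (2 * (cmod (\<Delta> e))\<^sup>2) - 1))"
proof -
  have nonneg: "0 \<le> likelihood_ratio n \<Delta> x" for x
    by (simp add: likelihood_ratio_def case_prod_unfold)
  have "(\<integral>\<^sup>+ x. ennreal (likelihood_ratio n \<Delta> x) \<partial>noise n p) = ennreal 1"
    by (simp add: nn_integral_likelihood_ratio)
  then show "(\<integral>x. likelihood_ratio n \<Delta> x \<partial>noise n p) = 1"
    by (subst (asm) nn_integral_eq_integrable) (auto simp: nonneg)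
  have "0 \<le> (\<Prod>e\<in>upper_pairs n. 1 + p * (exp (2 * (cmod (\<Delta> e))\<^sup>2) - 1))"
    using p by (intro prod_nonneg) simp
  then have "integrable (noise n p) (\<lambda>x. (likelihood_ratio n \<Delta> x)\<^sup>2) \<and>
      (\<integral>x. (likelihood_ratio n \<Delta> x)\<^sup>2 \<partial>noise n p) =
      (\<Prod>e\<in>upper_pairs n. 1 + p * (exp (2 * (cmod (\<Delta> e))\<^sup>2) - 1))"
    using nn_integral_likelihood_ratio_power2[OF p, of n \<Delta>]
    by (subst (asm) nn_integral_eq_integrable) auto
  then show "integrable (noise n p) (\<lambda>x. (likelihood_ratio n \<Delta> x)\<^sup>2)"
    and "(\<integral>x. (likelihood_ratio n \<Delta> x)\<^sup>2 \<partial>noise n p) =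
      (\<Prod>e\<in>upper_pairs n. 1 + p * (exp (2 * (cmod (\<Delta> e))\<^sup>2) - 1))"
    by blast+
qed

lemma measurable_estimator [measurable]:
  assumes "zh \<in> estimators n" "j < n"
  shows "(\<lambda>d. zh d j) \<in> borel_measurable (data_space n)"
proof -
  have "zh \<in> data_space n \<rightarrow>\<^sub>M (\<Pi>\<^sub>M j\<in>{..<n}. restrict_space borel (sphere 0 1))"
    using assms(1) by (simp add: estimators_def phase_space_def)
  moreover have "j \<in> {..<n}"
    using assms(2) by simp
  ultimately have "(\<lambda>d. zh d j) \<in> data_space n \<rightarrow>\<^sub>M restrict_space borel (sphere 0 1)"
    by (rule measurable_compose[OF _ measurable_component_singleton])
  then show ?thesis
    by (simp add: measurable_restrict_space2_iff)
qed

lemma cmod_estimator: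
  assumes "zh \<in> estimators n" "j < n" "d \<in> space (data_space n)"
  shows "cmod (zh d j) = 1"
proof -
  have "zh d \<in> space (phase_space n)"
    using assms by (auto simp: estimators_def intro: measurable_space)
  then show ?thesis
    using \<open>j < n\<close> by (auto simp: phase_space_def space_PiM space_restrict_space PiE_iff)
qed

text \<open>
  The mean of \<open>Re X\<close> for the error \<open>X\<close> in the relative phase of \<open>j\<close> and \<open>k\<close>, that is, the mean
  cosine of the angular error.
\<close>

definition phase_correlation ::
  "nat \<Rightarrow> real \<Rightarrow> real \<Rightarrow> ((nat \<times> nat \<Rightarrow> bool) \<times> (nat \<times> nat \<Rightarrow> complex) \<Rightarrow> nat \<Rightarrow> complex) \<Rightarrow>
    nat \<Rightarrow> nat \<Rightarrow> (nat \<Rightarrow> complex) \<Rightarrow> real" where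
  "phase_correlation n p \<sigma> zh j k z =
     (\<integral>x. Re (zh (observed_data n \<sigma> z x) j * cnj (zh (observed_data n \<sigma> z x) k) * cnj (z j * cnj (z k)))
        \<partial>noise n p)"

text \<open>
  The circular information inequality for the prior on the grid and the opposite turn of \<open>z\<^sub>j\<close> and
  \<open>z\<^sub>k\<close>. The turn permutes the grid, since \<open>cis h\<close> is an \<open>m\<close>-th root of unity; combined with the
  change of measure this is the invariance hypothesis.
\<close>

lemma sum_phase_correlation_le:
  assumes zh: "zh \<in> estimators n" and p: "0 < p" "p \<le> 1" and \<sigma>: "\<sigma> > 0"
    and jk: "j < n" "k < n" "j \<noteq> k" and m: "m > 0" and h: "cis h ^ m = 1" "cos h < 1"
  defines "\<kappa> \<equiv> chi_square_bound n p \<sigma> h"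
  shows "(\<Sum>z\<in>grid n m. phase_correlation n p \<sigma> zh j k z) \<le>
    card (grid n m) * sqrt ((1 + 2 * \<bar>sin h\<bar>) * \<kappa> / (4 * (sin h)\<^sup>2 + \<kappa>))"
proof -
  interpret prob_space "noise n p"
    by (rule prob_space_noise)
  let ?f = "opposite_turn h j k"
  let ?rot = "rotate_phases n ?f"
  define T where "T d = zh d j * cnj (zh d k)" for d
  define X where "X z x = T (observed_data n \<sigma> z x) * cnj (z j * cnj (z k))" for z x
  define R where "R z = likelihood_ratio n (drift \<sigma> z (?rot z))" for z
  define c where "c = (\<Sum>z\<in>grid n m. expectation (\<lambda>x. Re (X z x))) / card (grid n m)"
  note [measurable] = measurable_estimator[OF zh jk(1)] measurable_estimator[OF zh jk(2)]
  have T_meas [measurable]: "T \<in> borel_measurable (data_space n)"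
    unfolding T_def by measurable
  have \<kappa>: "\<kappa> > 0"
    using jk p \<sigma> h by (simp add: \<kappa>_def chi_square_bound_def)
  have f_root: "?f i ^ m = 1" for i
    using h(1) by (simp add: opposite_turn_def power_inverse flip: cis_inverse)
  have shift: "(\<Sum>z\<in>grid n m. expectation (X z)) =
      cis (-2 * h) * (\<Sum>z\<in>grid n m. expectation (\<lambda>x. R z x *\<^sub>R X z x))"
  proof -
    have "expectation (X (?rot z)) = cis (-2 * h) * expectation (\<lambda>x. R z x *\<^sub>R X z x)" for z
    proof -
      have turn: "cnj (?rot z j * cnj (?rot z k)) = cis (-2 * h) * cnj (z j * cnj (z k))"
        using jk by (simp add: rotate_phases_def opposite_turn_def cis_cnj cis_mult mult.left_commute flip: mult.assoc)
      have "expectation (X (?rot z)) =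
          expectation (\<lambda>x. T (observed_data n \<sigma> (?rot z) x)) * (cis (-2 * h) * cnj (z j * cnj (z k)))"
        unfolding X_def turn by simp
      also have "expectation (\<lambda>x. T (observed_data n \<sigma> (?rot z) x)) =
          expectation (\<lambda>x. R z x *\<^sub>R T (observed_data n \<sigma> z x))"
        unfolding R_def by (rule expectation_change[OF \<sigma> T_meas])
      also have "\<dots> * (cis (-2 * h) * cnj (z j * cnj (z k))) =
          cis (-2 * h) * (expectation (\<lambda>x. R z x *\<^sub>R T (observed_data n \<sigma> z x)) * cnj (z j * cnj (z k)))"
        by (simp only: ac_simps)
      also have "expectation (\<lambda>x. R z x *\<^sub>R T (observed_data n \<sigma> z x)) * cnj (z j * cnj (z k)) =
          expectation (\<lambda>x. R z x *\<^sub>R X z x)"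
        unfolding X_def by (subst integral_mult_left_zero[symmetric]) (simp only: mult_scaleR_left)
      finally show ?thesis .
    qed
    then show ?thesis
      using sum.reindex_bij_betw[OF bij_betw_rotate_phases[of m n ?f, OF m f_root], of "\<lambda>z. expectation (X z)"]
      by (simp add: sum_distrib_left)
  qed
  have "c\<^sup>2 * (4 * (sin h)\<^sup>2 + \<kappa>) \<le> (1 + 2 * \<bar>sin h\<bar>) * \<kappa>"
    unfolding c_def
  proof (rule circular_information_inequality[where R = R])
    fix z assume z: "z \<in> grid n m"
    show "X z \<in> borel_measurable (noise n p)"
      unfolding X_def by measurable
    show "cmod (X z x) = 1" if "x \<in> space (noise n p)" for x
      using cmod_estimator[OF zh jk(1)] cmod_estimator[OF zh jk(2)] cmod_grid[OF z m] jk
        measurable_space[OF measurable_observed_data that]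
      by (simp add: X_def T_def norm_mult)
    show "R z \<in> borel_measurable (noise n p)"
      unfolding R_def by measurable
    show "integrable (noise n p) (\<lambda>x. (R z x)\<^sup>2)" "expectation (R z) = 1"
      using p by (simp_all add: R_def likelihood_ratio_moments)
    show "expectation (\<lambda>x. (R z x)\<^sup>2) \<le> 1 + \<kappa>"
      using likelihood_ratio_turn_le[OF _ \<sigma> jk, of p z h] cmod_grid[OF z m] p
      by (simp add: R_def likelihood_ratio_moments \<kappa>_def)
  qed (use m \<kappa> shift in auto)
  moreover have pos: "4 * (sin h)\<^sup>2 + \<kappa> > 0"
    using \<kappa> zero_le_power2[of "sin h"] by linarith
  ultimately have "c\<^sup>2 \<le> (1 + 2 * \<bar>sin h\<bar>) * \<kappa> / (4 * (sin h)\<^sup>2 + \<kappa>)"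
    by (simp add: pos_le_divide_eq)
  then have "c \<le> sqrt ((1 + 2 * \<bar>sin h\<bar>) * \<kappa> / (4 * (sin h)\<^sup>2 + \<kappa>))"
    by (rule real_le_rsqrt)
  moreover have "(\<Sum>z\<in>grid n m. phase_correlation n p \<sigma> zh j k z) = card (grid n m) * c"
    using m by (simp add: c_def X_def T_def phase_correlation_def)
  ultimately show ?thesis
    by (simp add: mult_left_mono)
qed

section \<open>From relative phases to the loss\<close>

definition pair_loss :: "nat \<Rightarrow> (nat \<Rightarrow> complex) \<Rightarrow> (nat \<Rightarrow> complex) \<Rightarrow> real" where
  "pair_loss n u z = (\<Sum>j<n. \<Sum>k<n. (cmod (u j * cnj (u k) - z j * cnj (z k)))\<^sup>2) / (2 * real n)"

text \<open>
  With \<open>s = \<Sum>i. u\<^sub>i cnj z\<^sub>i\<close>, the loss is \<open>2 * (n - |s|)\<close> and the pair loss is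
  \<open>(n - |s|) * (n + |s|) / n\<close>, where \<open>|s| \<le> n\<close>. They agree to first order when the estimate
  is good, so no constant is lost.
\<close>

lemma pair_loss_le_loss:
  assumes u: "\<And>i. i < n \<Longrightarrow> cmod (u i) = 1" and z: "\<And>i. i < n \<Longrightarrow> cmod (z i) = 1" and n: "n > 0"
  shows "pair_loss n u z \<le> loss n u z"
  unfolding loss_def
proof (rule cINF_greatest)
  define s where "s = (\<Sum>i<n. u i * cnj (z i))"
  have "cmod s \<le> (\<Sum>i<n. cmod (u i * cnj (z i)))"
    unfolding s_def by (rule norm_sum)
  also have "\<dots> = real n"
    using u z by (simp add: norm_mult)
  finally have s: "cmod s \<le> real n" .
  fix a :: complex assume a: "a \<in> sphere 0 1"
  have "pair_loss n u z = ((real n)\<^sup>2 - (cmod s)\<^sup>2) / real n"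
  proof -
    have "(\<Sum>j<n. \<Sum>k<n. (cmod (u j * cnj (u k) - z j * cnj (z k)))\<^sup>2) = 2 * ((real n)\<^sup>2 - (cmod s)\<^sup>2)"
      using sum_cmod_pair_diff[of "{..<n}" u z] u z by (simp only: s_def lessThan_iff card_lessThan right_diff_distrib)
    then show ?thesis
      by (simp only: pair_loss_def mult_divide_mult_cancel_left_if) simp
  qed
  also have "\<dots> = (real n + cmod s) * (real n - cmod s) / real n"
    by (simp add: power2_eq_square algebra_simps)
  also have "\<dots> \<le> 2 * real n * (real n - cmod s) / real n"
    using s by (intro divide_right_mono mult_right_mono) auto
  also have "\<dots> = 2 * real n - 2 * cmod s"
    using n by (simp add: field_simps)
  also have "\<dots> \<le> 2 * real n - 2 * Re (a * s)"
    using complex_Re_le_cmod[of "a * s"] a by (simp add: norm_mult)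
  also have "\<dots> = (\<Sum>i<n. 2 - 2 * Re (a * (u i * cnj (z i))))"
    by (simp add: s_def sum_distrib_left sum_subtractf del: times_complex.sel)
  also have "\<dots> = (\<Sum>i<n. (cmod (u i * a - z i))\<^sup>2)"
  proof (rule sum.cong[OF refl])
    fix i assume "i \<in> {..<n}"
    then have "cmod (u i * a) = 1" "cmod (z i) = 1"
      using a u z by (simp_all add: norm_mult)
    then have "(cmod (u i * a - z i))\<^sup>2 = 2 - 2 * Re (u i * a * cnj (z i))"
      by (rule cmod_diff_unit)
    then show "2 - 2 * Re (a * (u i * cnj (z i))) = (cmod (u i * a - z i))\<^sup>2"
      by (simp only: ac_simps)
  qed
  finally show "pair_loss n u z \<le> (\<Sum>i<n. (cmod (u i * a - z i))\<^sup>2)" .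
qed (auto intro: exI[of _ 1])

lemma integral_pair_loss:
  assumes zh: "zh \<in> estimators n" and z: "\<And>i. i < n \<Longrightarrow> cmod (z i) = 1"
  shows "integrable (noise n p) (\<lambda>x. pair_loss n (zh (observed_data n \<sigma> z x)) z)"
    and "(\<integral>x. pair_loss n (zh (observed_data n \<sigma> z x)) z \<partial>noise n p) =
      (\<Sum>j<n. \<Sum>k<n. 2 - 2 * phase_correlation n p \<sigma> zh j k z) / (2 * real n)"
proof -
  interpret prob_space "noise n p"
    by (rule prob_space_noise)
  let ?C = "\<lambda>j k x. Re (zh (observed_data n \<sigma> z x) j * cnj (zh (observed_data n \<sigma> z x) k) * cnj (z j * cnj (z k)))"
  have u: "cmod (zh (observed_data n \<sigma> z x) i) = 1" if "x \<in> space (noise n p)" "i < n" for x i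
    using cmod_estimator[OF zh] measurable_space[OF measurable_observed_data] that by blast
  have C_int: "integrable (noise n p) (?C j k)" if "j < n" "k < n" for j k
  proof (rule integrable_const_bound[of _ 1])
    note [measurable] = measurable_estimator[OF zh that(1)] measurable_estimator[OF zh that(2)]
    show "?C j k \<in> borel_measurable (noise n p)"
      by measurable
    show "AE x in noise n p. norm (?C j k x) \<le> 1"
    proof (rule AE_I2)
      fix x assume "x \<in> space (noise n p)"
      then show "norm (?C j k x) \<le> 1"
        using abs_Re_le_cmod[of "zh (observed_data n \<sigma> z x) j * cnj (zh (observed_data n \<sigma> z x) k) * cnj (z j * cnj (z k))"]
          u z that unfolding real_norm_def by (simp only: norm_mult complex_mod_cnj mult_1)
    qed
  qed
  have pair: "pair_loss n (zh (observed_data n \<sigma> z x)) z = (\<Sum>j<n. \<Sum>k<n. 2 - 2 * ?C j k x) / (2 * real n)"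
    if "x \<in> space (noise n p)" for x
  proof -
    have "(cmod (zh (observed_data n \<sigma> z x) j * cnj (zh (observed_data n \<sigma> z x) k) - z j * cnj (z k)))\<^sup>2 =
        2 - 2 * ?C j k x" if "j < n" "k < n" for j k
      using u[OF \<open>x \<in> space (noise n p)\<close>] z that by (intro cmod_diff_unit) (simp_all add: norm_mult)
    then show ?thesis
      by (simp add: pair_loss_def del: complex_cnj_mult times_complex.sel)
  qed
  have C'_int: "integrable (noise n p) (\<lambda>x. 2 - 2 * ?C j k x)" if "j < n" "k < n" for j k
    using C_int[OF that] by (intro Bochner_Integration.integrable_diff integrable_mult_right) auto
  have "integrable (noise n p) (\<lambda>x. (\<Sum>j<n. \<Sum>k<n. 2 - 2 * ?C j k x) / (2 * real n))"
    by (intro integrable_divide_zero Bochner_Integration.integrable_sum C'_int) auto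
  then show "integrable (noise n p) (\<lambda>x. pair_loss n (zh (observed_data n \<sigma> z x)) z)"
    by (subst Bochner_Integration.integrable_cong[OF refl pair])
  have "(\<integral>x. pair_loss n (zh (observed_data n \<sigma> z x)) z \<partial>noise n p) =
      (\<integral>x. (\<Sum>j<n. \<Sum>k<n. 2 - 2 * ?C j k x) / (2 * real n) \<partial>noise n p)"
    by (rule Bochner_Integration.integral_cong[OF refl pair])
  also have "\<dots> = (\<integral>x. (\<Sum>j<n. \<Sum>k<n. 2 - 2 * ?C j k x) \<partial>noise n p) / (2 * real n)"
    by (rule integral_divide_zero)
  also have "(\<integral>x. (\<Sum>j<n. \<Sum>k<n. 2 - 2 * ?C j k x) \<partial>noise n p) =
      (\<Sum>j<n. \<integral>x. (\<Sum>k<n. 2 - 2 * ?C j k x) \<partial>noise n p)"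
    by (intro Bochner_Integration.integral_sum Bochner_Integration.integrable_sum C'_int) auto
  also have "\<dots> = (\<Sum>j<n. \<Sum>k<n. 2 - 2 * phase_correlation n p \<sigma> zh j k z)"
  proof (rule sum.cong[OF refl])
    fix j assume "j \<in> {..<n}"
    then have j: "j < n"
      by simp
    have "(\<integral>x. (\<Sum>k<n. 2 - 2 * ?C j k x) \<partial>noise n p) = (\<Sum>k<n. \<integral>x. 2 - 2 * ?C j k x \<partial>noise n p)"
      using j by (intro Bochner_Integration.integral_sum C'_int) auto
    also have "\<dots> = (\<Sum>k<n. 2 - 2 * phase_correlation n p \<sigma> zh j k z)"
    proof (rule sum.cong[OF refl])
      fix k assume "k \<in> {..<n}"
      then have "(\<integral>x. 2 - 2 * ?C j k x \<partial>noise n p) = (\<integral>x. 2 \<partial>noise n p) - (\<integral>x. 2 * ?C j k x \<partial>noise n p)"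
        using C_int[OF j] by (intro Bochner_Integration.integral_diff integrable_mult_right) auto
      then show "(\<integral>x. 2 - 2 * ?C j k x \<partial>noise n p) = 2 - 2 * phase_correlation n p \<sigma> zh j k z"
        unfolding phase_correlation_def integral_mult_right_zero by (simp only: lebesgue_integral_const prob_space scaleR_one)
    qed
    finally show "(\<integral>x. (\<Sum>k<n. 2 - 2 * ?C j k x) \<partial>noise n p) =
      (\<Sum>k<n. 2 - 2 * phase_correlation n p \<sigma> zh j k z)" .
  qed
  finally show "(\<integral>x. pair_loss n (zh (observed_data n \<sigma> z x)) z \<partial>noise n p) =
      (\<Sum>j<n. \<Sum>k<n. 2 - 2 * phase_correlation n p \<sigma> zh j k z) / (2 * real n)" .
qed

lemma phase_correlation_self:
  assumes "zh \<in> estimators n" "j < n" "\<And>i. i < n \<Longrightarrow> cmod (z i) = 1"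
  shows "phase_correlation n p \<sigma> zh j j z = 1"
proof -
  interpret prob_space "noise n p"
    by (rule prob_space_noise)
  have unit: "w * cnj w = 1" if "cmod w = 1" for w
    using complex_norm_square[of w] that by simp
  have "phase_correlation n p \<sigma> zh j j z = (\<integral>x. 1 \<partial>noise n p)"
    unfolding phase_correlation_def
  proof (rule Bochner_Integration.integral_cong[OF refl])
    fix x assume "x \<in> space (noise n p)"
    then have "observed_data n \<sigma> z x \<in> space (data_space n)"
      by (rule measurable_space[OF measurable_observed_data])
    then show "Re (zh (observed_data n \<sigma> z x) j * cnj (zh (observed_data n \<sigma> z x) j) * cnj (z j * cnj (z j))) = 1"
      using cmod_estimator[OF assms(1,2)] assms(2,3) by (simp only: unit complex_cnj_one mult_1 one_complex.sel)
  qed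
  then show ?thesis
    by (simp add: prob_space)
qed

definition correlation_bound :: "nat \<Rightarrow> real \<Rightarrow> real \<Rightarrow> real \<Rightarrow> real" where
  "correlation_bound n p \<sigma> h = sqrt ((1 + 2 * \<bar>sin h\<bar>) * chi_square_bound n p \<sigma> h /
     (4 * (sin h)\<^sup>2 + chi_square_bound n p \<sigma> h))"

text \<open>
  The supremum over all signals is at least the average over the grid, and the average of the pair
  loss has \<open>n * (n - 1)\<close> terms off the diagonal, each at least
  \<open>2 - 2 * correlation_bound n p \<sigma> h\<close> before the division by \<open>2 * n\<close>.
\<close>

lemma minimax_risk_ge_correlation_bound:
  assumes n: "n > 0" and p: "0 < p" "p \<le> 1" and \<sigma>: "\<sigma> > 0"
    and m: "m > 0" and h: "cis h ^ m = 1" "cos h < 1"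
  shows "minimax_risk n p \<sigma> \<ge> ennreal ((real n - 1) * (1 - correlation_bound n p \<sigma> h))"
  unfolding minimax_risk_def
proof (rule INF_greatest)
  fix zh assume zh: "zh \<in> estimators n"
  let ?V = "(real n - 1) * (1 - correlation_bound n p \<sigma> h)"
  let ?r = "\<lambda>z. \<integral>x. pair_loss n (zh (observed_data n \<sigma> z x)) z \<partial>noise n p"
  let ?N = "real (card (grid n m))"
  have unit: "cmod (z i) = 1" if "z \<in> grid n m" "i < n" for z i
    using cmod_grid[OF that(1) m that(2)] .
  have entry: "(\<Sum>z\<in>grid n m. 2 - 2 * phase_correlation n p \<sigma> zh j k z) \<ge>
      (if j = k then 0 else ?N * (2 - 2 * correlation_bound n p \<sigma> h))" if "j < n" "k < n" for j k
  proof (cases "j = k")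
    case True
    then show ?thesis
      using phase_correlation_self[OF zh that(1)] unit by simp
  next
    case False
    have "(\<Sum>z\<in>grid n m. 2 - 2 * phase_correlation n p \<sigma> zh j k z) =
        2 * ?N - 2 * (\<Sum>z\<in>grid n m. phase_correlation n p \<sigma> zh j k z)"
      by (simp add: sum_subtractf sum_distrib_left)
    then show ?thesis
      using False sum_phase_correlation_le[OF zh p \<sigma> that False m h]
      by (simp add: correlation_bound_def right_diff_distrib)
  qed
  have "?N * ?V = (\<Sum>j<n. \<Sum>k<n. if j = k then 0 else ?N * (2 - 2 * correlation_bound n p \<sigma> h)) / (2 * real n)"
  proof -
    have "(\<Sum>k<n. if j = k then 0 else ?N * (2 - 2 * correlation_bound n p \<sigma> h)) =
        (real n - 1) * (?N * (2 - 2 * correlation_bound n p \<sigma> h))" if "j < n" for j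
    proof -
      have "(\<Sum>k<n. if j = k then 0 else ?N * (2 - 2 * correlation_bound n p \<sigma> h)) =
          (\<Sum>k\<in>{..<n} - {j}. ?N * (2 - 2 * correlation_bound n p \<sigma> h))"
        by (rule sum.mono_neutral_cong_right) auto
      then show ?thesis
        using that by (simp add: of_nat_diff)
    qed
    then have "(\<Sum>j<n. \<Sum>k<n. if j = k then 0 else ?N * (2 - 2 * correlation_bound n p \<sigma> h)) =
        (\<Sum>j<n. (real n - 1) * (?N * (2 - 2 * correlation_bound n p \<sigma> h)))"
      by (intro sum.cong) auto
    then show ?thesis
      using n by (simp add: field_simps)
  qed
  also have "\<dots> \<le> (\<Sum>j<n. \<Sum>k<n. \<Sum>z\<in>grid n m. 2 - 2 * phase_correlation n p \<sigma> zh j k z) / (2 * real n)"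
    by (intro divide_right_mono sum_mono entry) auto
  also have "\<dots> = (\<Sum>z\<in>grid n m. ?r z)"
  proof -
    have "(\<Sum>j<n. \<Sum>k<n. \<Sum>z\<in>grid n m. 2 - 2 * phase_correlation n p \<sigma> zh j k z) =
        (\<Sum>z\<in>grid n m. \<Sum>j<n. \<Sum>k<n. 2 - 2 * phase_correlation n p \<sigma> zh j k z)"
    proof -
      have "(\<Sum>j<n. \<Sum>k<n. \<Sum>z\<in>grid n m. 2 - 2 * phase_correlation n p \<sigma> zh j k z) =
          (\<Sum>j<n. \<Sum>z\<in>grid n m. \<Sum>k<n. 2 - 2 * phase_correlation n p \<sigma> zh j k z)"
        by (intro sum.cong refl sum.swap)
      also have "\<dots> = (\<Sum>z\<in>grid n m. \<Sum>j<n. \<Sum>k<n. 2 - 2 * phase_correlation n p \<sigma> zh j k z)"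
        by (rule sum.swap)
      finally show ?thesis .
    qed
    then show ?thesis
      using unit by (simp add: integral_pair_loss(2)[OF zh] flip: sum_divide_distrib)
  qed
  finally have avg: "?N * ?V \<le> (\<Sum>z\<in>grid n m. ?r z)" .
  have "\<exists>z\<in>grid n m. ?V \<le> ?r z"
  proof (rule ccontr)
    assume "\<not> (\<exists>z\<in>grid n m. ?V \<le> ?r z)"
    then have "?r z < ?V" if "z \<in> grid n m" for z
      using that by (meson not_le)
    from sum_strict_mono[OF finite_grid[OF m] grid_nonempty[OF m] this]
    have "(\<Sum>z\<in>grid n m. ?r z) < (\<Sum>z\<in>grid n m. ?V)" .
    with avg show False
      by (simp only: sum_constant)
  qed
  then obtain z where z: "z \<in> grid n m" and V: "?V \<le> ?r z"
    by blast
  have zh_unit: "cmod (zh d i) = 1" if "d \<in> space (data_space n)" "i < n" for d i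
    using cmod_estimator[OF zh that(2,1)] .
  have [measurable]: "(\<lambda>d. pair_loss n (zh d) z) \<in> borel_measurable (data_space n)"
    unfolding pair_loss_def using measurable_estimator[OF zh] by measurable
  have "ennreal ?V \<le> ennreal (?r z)"
    using V by (rule ennreal_leI)
  also have "\<dots> = (\<integral>\<^sup>+ x. ennreal (pair_loss n (zh (observed_data n \<sigma> z x)) z) \<partial>noise n p)"
    using integral_pair_loss(1)[OF zh unit[OF z]]
    by (intro nn_integral_eq_integral[symmetric]) (auto simp: pair_loss_def intro!: divide_nonneg_nonneg sum_nonneg)
  also have "\<dots> = (\<integral>\<^sup>+ d. ennreal (pair_loss n (zh d) z) \<partial>data_law n p \<sigma> z)"
    unfolding data_law_def by (rule nn_integral_distr[symmetric]) measurable
  also have "\<dots> \<le> (\<integral>\<^sup>+ d. ennreal (loss n (zh d) z) \<partial>data_law n p \<sigma> z)"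
    using zh_unit unit[OF z] n
    by (intro nn_integral_mono ennreal_leI pair_loss_le_loss) (auto simp: data_law_def)
  also have "\<dots> \<le> (SUP z\<in>({..<n} \<rightarrow>\<^sub>E sphere 0 1). \<integral>\<^sup>+ d. ennreal (loss n (zh d) z) \<partial>data_law n p \<sigma> z)"
  proof (rule SUP_upper)
    show "z \<in> {..<n} \<rightarrow>\<^sub>E sphere 0 1"
      using z unit[OF z] by (auto simp: grid_def PiE_iff)
  qed
  finally show "ennreal ?V \<le> (SUP z\<in>({..<n} \<rightarrow>\<^sub>E sphere 0 1). \<integral>\<^sup>+ d. ennreal (loss n (zh d) z) \<partial>data_law n p \<sigma> z)" .
qed

section \<open>Refining the grid\<close>

text \<open>
  With \<open>a = 4 n p / \<sigma>\<^sup>2\<close>, the quotient under the root behaves like \<open>a h\<^sup>2 / (4 h\<^sup>2 + a h\<^sup>2)\<close>.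
\<close>

lemma correlation_bound_tendsto:
  assumes n: "n > 0" and p: "0 < p" and \<sigma>: "\<sigma> > 0"
  shows "(correlation_bound n p \<sigma> \<longlongrightarrow> 1 / sqrt (1 + \<sigma>\<^sup>2 / (real n * p))) (at_right 0)"
proof -
  define a b where "a = 4 * real n * p / \<sigma>\<^sup>2" and "b = 8 / \<sigma>\<^sup>2"
  have ab: "a > 0" "b > 0"
    using assms by (auto simp: a_def b_def)
  have "((\<lambda>h. (1 + 2 * \<bar>sin h\<bar>) * (exp (a * (2 - 2 * cos h) * exp (b * (2 - 2 * cos h))) - 1) /
      (4 * (sin h)\<^sup>2 + (exp (a * (2 - 2 * cos h) * exp (b * (2 - 2 * cos h))) - 1))) \<longlongrightarrow> a * inverse (4 + a)) (at_right 0)"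
    using ab by real_asymp
  then have "(correlation_bound n p \<sigma> \<longlongrightarrow> sqrt (a / (4 + a))) (at_right 0)"
    unfolding correlation_bound_def chi_square_bound_def a_def b_def divide_inverse[symmetric]
    by (rule tendsto_real_sqrt)
  also have "a / (4 + a) = 1 / (1 + \<sigma>\<^sup>2 / (real n * p))"
  proof -
    define \<epsilon> where "\<epsilon> = \<sigma>\<^sup>2 / (real n * p)"
    have "\<epsilon> > 0" "a = 4 / \<epsilon>"
      using assms by (simp_all add: \<epsilon>_def a_def)
    moreover have "4 + a \<noteq> 0"
      using ab(1) by simp
    ultimately show ?thesis
      unfolding \<epsilon>_def[symmetric] by (subst frac_eq_eq) (auto simp: distrib_left)
  qed
  finally show ?thesis
    by (simp add: real_sqrt_divide)
qed

lemma minimax_risk_ge: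
  assumes n: "n > 0" and p: "0 < p" "p \<le> 1" and \<sigma>: "\<sigma> > 0"
  shows "minimax_risk n p \<sigma> \<ge> ennreal ((real n - 1) * (1 - 1 / sqrt (1 + \<sigma>\<^sup>2 / (real n * p))))"
proof (rule Lim_bounded)
  have "filterlim (\<lambda>m. 2 * pi / real m) (at_right 0) sequentially"
    by real_asymp
  from filterlim_compose[OF correlation_bound_tendsto[OF n p(1) \<sigma>] this]
  \<comment> \<open>the grid spacing tends to \<open>0\<close> while the risk stays fixed\<close>
  show "(\<lambda>m. ennreal ((real n - 1) * (1 - correlation_bound n p \<sigma> (2 * pi / real m)))) \<longlonglongrightarrow>
      ennreal ((real n - 1) * (1 - 1 / sqrt (1 + \<sigma>\<^sup>2 / (real n * p))))"
    by (intro tendsto_ennrealI tendsto_intros)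
  show "\<forall>m\<ge>2. ennreal ((real n - 1) * (1 - correlation_bound n p \<sigma> (2 * pi / real m))) \<le> minimax_risk n p \<sigma>"
  proof (intro allI impI)
    fix m :: nat assume m: "2 \<le> m"
    have "cis (2 * pi / real m) ^ m = 1"
      using m by (simp add: Complex.DeMoivre)
    moreover have "cos (2 * pi / real m) < cos 0"
      using m by (intro cos_monotone_0_pi) (auto simp: field_simps)
    ultimately show "ennreal ((real n - 1) * (1 - correlation_bound n p \<sigma> (2 * pi / real m))) \<le> minimax_risk n p \<sigma>"
      using m by (intro minimax_risk_ge_correlation_bound[OF n p \<sigma>, of m]) auto
  qed
qed

text \<open>
  The left side is the second-order Taylor polynomial of the right side at \<open>0\<close>. For \<open>x > 4 / 3\<close> it is negative.
\<close>

lemma one_minus_inverse_sqrt_ge: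
  fixes x :: real
  assumes "x \<ge> 0"
  shows "x / 2 - 3 / 8 * x\<^sup>2 \<le> 1 - 1 / sqrt (1 + x)"
proof (cases "x \<le> 4 / 3")
  case True
  let ?t = "1 - x / 2 + 3 / 8 * x\<^sup>2"
  have "?t\<^sup>2 * (1 + x) - 1 = x ^ 3 / 64 * (40 - 15 * x + 9 * x\<^sup>2)"
    by (simp add: power2_eq_square power3_eq_cube field_simps)
  moreover have "0 \<le> x ^ 3 / 64 * (40 - 15 * x + 9 * x\<^sup>2)"
  proof -
    have "0 \<le> 40 - 15 * x + 9 * x\<^sup>2"
      using True zero_le_power2[of x] by linarith
    then show ?thesis
      using assms by simp
  qed
  ultimately have "1 / (1 + x) \<le> ?t\<^sup>2"
    using assms by (simp add: pos_divide_le_eq)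
  then have "sqrt (1 / (1 + x)) \<le> sqrt (?t\<^sup>2)"
    by (rule real_sqrt_le_mono)
  moreover have "?t \<ge> 0"
    using True zero_le_power2[of x] by linarith
  ultimately have "1 / sqrt (1 + x) \<le> ?t"
    by (simp add: real_sqrt_divide)
  then show ?thesis
    by linarith
next
  case False
  then have "x / 2 - 3 / 8 * x\<^sup>2 \<le> 0"
    using mult_left_mono[of "4 / 3" x x] by (simp add: power2_eq_square)
  moreover have "1 / sqrt (1 + x) \<le> 1"
    using assms by simp
  ultimately show ?thesis
    by linarith
qed

theorem theorem4p1:
  fixes p \<sigma> :: "nat \<Rightarrow> real"
  assumes p: "\<And>n. 0 < p n \<and> p n \<le> 1"
    and \<sigma>: "\<And>n. 0 < \<sigma> n"
    and noise_level: "(\<lambda>n. (\<sigma> n)\<^sup>2) \<in> o(\<lambda>n. real n * p n)"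
  shows "\<exists>\<delta> :: nat \<Rightarrow> real.
    \<delta> \<in> o(\<lambda>_. 1) \<and>
    \<delta> \<in> O(\<lambda>n. (\<sigma> n)\<^sup>2 / (real n * p n) + 1 / real n) \<and>
    (\<forall>\<^sub>F n in sequentially.
      minimax_risk n (p n) (\<sigma> n) \<ge> ennreal ((1 - \<delta> n) * ((\<sigma> n)\<^sup>2 / (2 * p n))))"
proof -
  define \<epsilon> where "\<epsilon> n = (\<sigma> n)\<^sup>2 / (real n * p n)" for n
  \<comment> \<open>\<open>(1 - 1 / n) * (1 - 3 / 4 * \<epsilon>) \<ge> 1 - \<delta>\<close>, the relative losses of the pair count and of the expansion\<close>
  define \<delta> where "\<delta> n = 3 / 4 * \<epsilon> n + 1 / real n" for n
  have \<epsilon>_nonneg: "\<epsilon> n \<ge> 0" for n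
    using p[of n] by (simp add: \<epsilon>_def)
  have "\<epsilon> \<in> o(\<lambda>_. 1)"
  proof -
    have "(\<lambda>n. (\<sigma> n)\<^sup>2 / (real n * p n)) \<longlonglongrightarrow> 0"
      using noise_level by (rule smalloD_tendsto)
    then show ?thesis
      by (intro smalloI_tendsto) (simp_all add: \<epsilon>_def[abs_def])
  qed
  then have small: "\<delta> \<in> o(\<lambda>_. 1)"
    unfolding \<delta>_def by (intro sum_in_smallo landau_o.small.cmult_in_iff[THEN iffD2]) (simp, assumption, real_asymp)
  have big: "\<delta> \<in> O(\<lambda>n. \<epsilon> n + 1 / real n)"
    by (rule bigoI[of _ 1], rule always_eventually) (use \<epsilon>_nonneg in \<open>auto simp: \<delta>_def\<close>)
  have "minimax_risk n (p n) (\<sigma> n) \<ge> ennreal ((1 - \<delta> n) * ((\<sigma> n)\<^sup>2 / (2 * p n)))" if n: "n > 0" for n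
  proof -
    have "(1 - \<delta> n) * ((\<sigma> n)\<^sup>2 / (2 * p n)) = real n * (1 - \<delta> n) * (\<epsilon> n / 2)"
      using n p[of n] by (simp add: \<epsilon>_def)
    also have "\<dots> \<le> (real n - 1) * (1 - 3 / 4 * \<epsilon> n) * (\<epsilon> n / 2)"
    proof (rule mult_right_mono)
      have "real n * (1 - \<delta> n) = real n - 1 - 3 / 4 * \<epsilon> n * real n"
        using n by (simp add: \<delta>_def field_simps)
      then show "real n * (1 - \<delta> n) \<le> (real n - 1) * (1 - 3 / 4 * \<epsilon> n)"
        using \<epsilon>_nonneg[of n] unfolding left_diff_distrib right_diff_distrib
        by (simp add: mult.commute)
    qed (use \<epsilon>_nonneg in simp)
    also have "\<dots> = (real n - 1) * (\<epsilon> n / 2 - 3 / 8 * (\<epsilon> n)\<^sup>2)"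
      by (simp add: power2_eq_square field_simps)
    also have "\<dots> \<le> (real n - 1) * (1 - 1 / sqrt (1 + \<epsilon> n))"
      using n one_minus_inverse_sqrt_ge[OF \<epsilon>_nonneg] by (intro mult_left_mono) auto
    finally have "ennreal ((1 - \<delta> n) * ((\<sigma> n)\<^sup>2 / (2 * p n))) \<le>
        ennreal ((real n - 1) * (1 - 1 / sqrt (1 + \<epsilon> n)))"
      by (rule ennreal_leI)
    also have "\<dots> \<le> minimax_risk n (p n) (\<sigma> n)"
      using minimax_risk_ge[OF n, of "p n" "\<sigma> n"] p[of n] \<sigma>[of n] by (simp add: \<epsilon>_def)
    finally show ?thesis .
  qed
  then have "\<forall>\<^sub>F n in sequentially.
      minimax_risk n (p n) (\<sigma> n) \<ge> ennreal ((1 - \<delta> n) * ((\<sigma> n)\<^sup>2 / (2 * p n)))"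
    by (rule eventually_mono[OF eventually_gt_at_top[of 0]])
  with small big show ?thesis
    unfolding \<epsilon>_def by blast
qed

end
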